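(* Let $p\in[1,\infty]$ and let $(S_T^1,\dots,S_T^n)$ be an i.i.d. vector of Lévy's stochastic areas on $[0,T]$. Then $$\lim_{x\to+\infty}\frac{\log P\big(|(S_T^1,\dots,S_T^n)|_p\ge x\big)}x=-\frac\pi T.$$
   Context: Lévy's stochastic area on $[0,T]$ is $S_T=\frac12\int_0^T\big(B^1(t)\,dB^2(t)-B^2(t)\,dB^1(t)\big)$, where $(B^1(t),B^2(t))_{t\ge0}$ is a two-dimensional Brownian motion. $|\cdot|_p$ is the $\ell^p$-norm on $\mathbb R^n$. *)

theory Defs
  imports "HOL-Probability.Probability"
begin

definition natural_filtration ::
  "'a measure \<Rightarrow> (real \<Rightarrow> 'a \<Rightarrow> 'b::topological_space) \<Rightarrow> real \<Rightarrow> 'a measure" where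
  "natural_filtration M B t =
     sigma (space M) {B s -` A \<inter> space M | s A. 0 \<le> s \<and> s \<le> t \<and> A \<in> sets borel}"

text \<open>Standard \<open>d\<close>-dimensional Brownian motion started at the origin. The increments over
  \<open>[s, t]\<close> are centred Gaussian with covariance \<open>t - s\<close> times the identity, which is expressed by
  their joint Lebesgue density; \<^const>\<open>normal_density\<close> takes the standard deviation as its second
  argument.\<close>

definition brownian_motion ::
  "'a measure \<Rightarrow> (real \<Rightarrow> 'a \<Rightarrow> real ^ 'd::finite) \<Rightarrow> bool" where
  "brownian_motion M B \<longleftrightarrow>
     prob_space M \<and>
     (\<forall>t\<ge>0. B t \<in> borel_measurable M) \<and>
     (AE \<omega> in M. B 0 \<omega> = 0) \<and>
     (\<forall>s t. 0 \<le> s \<and> s < t \<longrightarrow>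
        prob_space.indep_set M
          (sets (natural_filtration M B s))
          {(\<lambda>\<omega>. B t \<omega> - B s \<omega>) -` A \<inter> space M | A. A \<in> sets borel} \<and>
        distributed M lborel (\<lambda>\<omega>. B t \<omega> - B s \<omega>)
          (\<lambda>x. \<Prod>i\<in>UNIV. normal_density 0 (sqrt (t - s)) (x $ i))) \<and>
     (AE \<omega> in M. continuous_on {0..} (\<lambda>t. B t \<omega>))"

text \<open>A simple integrand is \<open>\<Sum>k<m. \<xi> k * 1\<^bsub>(\<tau> k, \<tau> (k+1)]\<^esub>\<close> with \<open>0 = \<tau> 0 \<le> \<dots> \<le> \<tau> m = T\<close>
  deterministic and each \<open>\<xi> k\<close> bounded and measurable at time \<open>\<tau> k\<close>.\<close>

definition simple_integrand ::
  "(real \<Rightarrow> 'a measure) \<Rightarrow> real \<Rightarrow> nat \<Rightarrow> (nat \<Rightarrow> real) \<Rightarrow> (nat \<Rightarrow> 'a \<Rightarrow> real) \<Rightarrow> bool" where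
  "simple_integrand F T m \<tau> \<xi> \<longleftrightarrow>
     \<tau> 0 = 0 \<and> \<tau> m = T \<and> (\<forall>k<m. \<tau> k \<le> \<tau> (Suc k)) \<and>
     (\<forall>k<m. \<xi> k \<in> borel_measurable (F (\<tau> k)) \<and>
        (\<exists>C. \<forall>\<omega>\<in>space (F (\<tau> k)). \<bar>\<xi> k \<omega>\<bar> \<le> C))"

definition simple_process ::
  "nat \<Rightarrow> (nat \<Rightarrow> real) \<Rightarrow> (nat \<Rightarrow> 'a \<Rightarrow> real) \<Rightarrow> real \<Rightarrow> 'a \<Rightarrow> real" where
  "simple_process m \<tau> \<xi> t \<omega> = (\<Sum>k<m. \<xi> k \<omega> * indicator {\<tau> k <.. \<tau> (Suc k)} t)"

definition simple_ito_integral ::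
  "(real \<Rightarrow> 'a \<Rightarrow> real) \<Rightarrow> nat \<Rightarrow> (nat \<Rightarrow> real) \<Rightarrow> (nat \<Rightarrow> 'a \<Rightarrow> real) \<Rightarrow> 'a \<Rightarrow> real" where
  "simple_ito_integral W m \<tau> \<xi> \<omega> = (\<Sum>k<m. \<xi> k \<omega> * (W (\<tau> (Suc k)) \<omega> - W (\<tau> k) \<omega>))"

text \<open>\<open>has_ito_integral M F W T H I\<close>: the random variable \<open>I\<close> is a version of
  \<open>\<integral>\<^sub>0\<^sup>T H(t) dW(t)\<close>, the \<open>L\<^sup>2\<close> extension of the integral of simple integrands. An Ito integral
  is determined only up to null sets, hence a relation instead of a function.
  Joint measurability is asked for the completed product measure, because a process with almost
  surely continuous paths need not be measurable for the product sigma-algebra itself.\<close>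

definition has_ito_integral ::
  "'a measure \<Rightarrow> (real \<Rightarrow> 'a measure) \<Rightarrow> (real \<Rightarrow> 'a \<Rightarrow> real) \<Rightarrow> real \<Rightarrow>
   (real \<Rightarrow> 'a \<Rightarrow> real) \<Rightarrow> ('a \<Rightarrow> real) \<Rightarrow> bool" where
  "has_ito_integral M F W T H I \<longleftrightarrow>
     I \<in> borel_measurable M \<and>
     (\<lambda>(\<omega>, t). H t \<omega>) \<in>
       borel_measurable (completion (M \<Otimes>\<^sub>M restrict_space lborel {0..T})) \<and>
     (\<exists>m \<tau> \<xi>.
        (\<forall>j. simple_integrand F T (m j) (\<tau> j) (\<xi> j)) \<and>
        (\<lambda>j. \<integral>\<^sup>+ (\<omega>, t). ennreal ((simple_process (m j) (\<tau> j) (\<xi> j) t \<omega> - H t \<omega>)\<^sup>2)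
               \<partial>completion (M \<Otimes>\<^sub>M restrict_space lborel {0..T})) \<longlonglongrightarrow> 0 \<and>
        (\<lambda>j. \<integral>\<^sup>+ \<omega>. ennreal ((simple_ito_integral W (m j) (\<tau> j) (\<xi> j) \<omega> - I \<omega>)\<^sup>2) \<partial>M)
          \<longlonglongrightarrow> 0)"

definition levy_area ::
  "'a measure \<Rightarrow> (real \<Rightarrow> 'a \<Rightarrow> real ^ 2) \<Rightarrow> real \<Rightarrow> ('a \<Rightarrow> real) \<Rightarrow> bool" where
  "levy_area M B T S \<longleftrightarrow>
     brownian_motion M B \<and>
     S \<in> borel_measurable M \<and>
     (\<exists>I J.
        has_ito_integral M (natural_filtration M B) (\<lambda>t \<omega>. B t \<omega> $ 2) T (\<lambda>t \<omega>. B t \<omega> $ 1) I \<and>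
        has_ito_integral M (natural_filtration M B) (\<lambda>t \<omega>. B t \<omega> $ 1) T (\<lambda>t \<omega>. B t \<omega> $ 2) J \<and>
        (AE \<omega> in M. S \<omega> = 1 / 2 * (I \<omega> - J \<omega>)))"

definition lp_norm :: "ereal \<Rightarrow> real ^ 'n::finite \<Rightarrow> real" where
  "lp_norm p v =
     (if p = \<infinity> then infnorm v
      else (\<Sum>i\<in>UNIV. \<bar>v $ i\<bar> powr real_of_ereal p) powr (1 / real_of_ereal p))"

end

theory Submission
  imports Defs
begin

text \<open>The Ito isometry shows that the area is the \<open>L\<^sup>2\<close> limit of its Riemann sums along uniform
  partitions into \<open>n\<close> intervals. Integrating out the increments one by one, from the last to the
  first, keeps the integrand a radial Gaussian function of the current position; this yields the
  characteristic function \<open>2 / ((1 + u T / 2n)^n + (1 - u T / 2n)^n)\<close> of the Riemann sum, hence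
  \<open>1 / cosh (u T / 2)\<close> for the area. By the reflection formula for \<open>\<Gamma>(1/2 + i s)\<close>, this is also the
  characteristic function of \<open>T / (2 \<pi>) * (ln G - ln G')\<close> for independent \<open>G, G'\<close> with the
  \<open>\<Gamma>(1/2)\<close>-distribution. For this variable, restricting to \<open>G \<ge> 1\<close> and small \<open>G'\<close> bounds the tail from
  below, and the Gamma integral gives the exponential moments of all orders less than \<open>\<pi> / T\<close>.
  Finally, the \<open>\<ell>\<^sup>p\<close>-norm lies between the modulus of one component and the sum of all moduli.\<close>

subsection \<open>Log-ratio of independent Gamma variables\<close>

text \<open>The area has density 1 / (T cosh (pi x / T)), the density of the scaled log-ratio.
  Neither this density nor Fourier inversion is used: uniqueness of characteristic functions
  identifies the law, and both tail bounds are read off from the Gamma law. The scale c = T / (2 pi)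
  is forced by cosh (pi c u) = cosh (T u / 2). The rate 1 / (2 c) = pi / T stems from the
  singularity of the Gamma density at 0, of order -1/2: G' <= exp (- x / c) has probability of order
  exp (- x / (2 c)), and negative powers of G' are integrable up to order 1/2, exclusively. The
  number of components affects only the constant in the upper bound, and p not even that. The
  obstacle is the stochastic integral, known only as a limit along some sequence of bounded simple
  integrands. Riemann sums have unbounded Gaussian coefficients and are not among these. Hence the
  isometry is proved for square-integrable adapted coefficients, and a Riemann sum is compared with
  every member of the unknown sequence before passing to the limit.\<close>

definition half_gamma :: "real measure" where
  "half_gamma = density lborel (\<lambda>x. indicator {0<..} x * (x powr (- 1 / 2) / exp x) / sqrt pi)"

lemma sets_half_gamma [measurable_cong, simp]: "sets half_gamma = sets borel"
  by (simp add: half_gamma_def)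

lemma space_half_gamma [simp]: "space half_gamma = UNIV"
  by (simp add: half_gamma_def)

lemma AE_half_gamma_pos: "AE x in half_gamma. x > 0"
  unfolding half_gamma_def by (subst AE_density) (auto simp: indicator_def)

text \<open>Multiplication by \<open>x powr a\<close> only shifts the exponent in Euler's integral;
  \<open>a > - 1 / 2\<close> keeps the argument of \<open>Gamma\<close> positive. This threshold
  becomes the critical exponent of the tail.\<close>

lemma nn_integral_half_gamma_powr:
  assumes "a > - 1 / 2"
  shows "(\<integral>\<^sup>+x. ennreal (x powr a) \<partial>half_gamma) = ennreal (Gamma (a + 1 / 2) / sqrt pi)"
proof -
  have pos: "a + 1 / 2 > 0" using assms by simp
  have "(\<integral>\<^sup>+x. ennreal (x powr a) \<partial>half_gamma) =
      (\<integral>\<^sup>+x. ennreal (1 / sqrt pi) * ennreal (indicator {0..} x * x powr (a + 1 / 2 - 1) / exp x) \<partial>lborel)"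
    unfolding half_gamma_def
    by (subst nn_integral_density)
       (auto intro!: nn_integral_cong simp: indicator_def ennreal_mult' [symmetric] powr_add [symmetric]
         algebra_simps)
  also have "\<dots> = ennreal (1 / sqrt pi) * ennreal (Gamma (a + 1 / 2))"
    by (subst nn_integral_cmult) (auto simp: Gamma_conv_nn_integral_real[OF pos])
  also have "\<dots> = ennreal (Gamma (a + 1 / 2) / sqrt pi)"
    by (simp add: ennreal_mult' [symmetric])
  finally show ?thesis .
qed

lemma prob_space_half_gamma: "prob_space half_gamma"
proof
  have "emeasure half_gamma (space half_gamma) = (\<integral>\<^sup>+x. 1 \<partial>half_gamma)"
    by simp
  \<comment> \<open>Equality holds only almost everywhere, as \<open>0 powr 0 = 0\<close>.\<close>
  also have "\<dots> = (\<integral>\<^sup>+x. ennreal (x powr 0) \<partial>half_gamma)"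
    using AE_half_gamma_pos by (intro nn_integral_cong_AE) auto
  also have "\<dots> = 1"
    by (subst nn_integral_half_gamma_powr) (auto simp: Gamma_one_half_real)
  finally show "emeasure half_gamma (space half_gamma) = 1" .
qed

text \<open>For positive \<open>x\<close>, \<open>iexp (s * ln x)\<close> is \<open>x\<close> to the
  power \<open>\<i> * s\<close>, so this is Euler's integral on the line with real part 1/2.\<close>

lemma integral_half_gamma_iexp_ln:
  "(CLINT x|half_gamma. iexp (s * ln x)) = Gamma (1 / 2 + \<i> * s) / sqrt pi"
proof -
  define z where "z = 1 / 2 + \<i> * complex_of_real s"
  define f where "f = (\<lambda>t. complex_of_real t powr (z - 1) / of_real (exp t))"
  have "Re z > 0" by (simp add: z_def)
  \<comment> \<open>Euler's integral with complex argument is a gauge integral. Absolute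
    integrability turns it into an integral over \<open>lebesgue\<close>, which agrees with the one
    over \<open>lborel\<close> for a Borel integrand.\<close>
  have "set_lebesgue_integral lebesgue {0<..} f = integral {0<..} f"
    using absolutely_integrable_Gamma_integral'[OF \<open>Re z > 0\<close>]
    unfolding f_def by (rule set_lebesgue_integral_eq_integral(2))
  also have "\<dots> = Gamma z"
    unfolding f_def by (rule integral_unique[OF Gamma_integral_complex'[OF \<open>Re z > 0\<close>]])
  finally have 1: "set_lebesgue_integral lebesgue {0<..} f = Gamma z" .
  have 2: "(\<lambda>t. indicator {0<..} t *\<^sub>R (iexp (s * ln t) * of_real (t powr (- 1 / 2) / exp t)))
      = (\<lambda>t. indicator {0<..} t *\<^sub>R f t)"
  proof
    fix t :: real
    show "indicator {0<..} t *\<^sub>R (iexp (s * ln t) * of_real (t powr (- 1 / 2) / exp t))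
      = indicator {0<..} t *\<^sub>R f t"
    proof (cases "t > 0")
      case True
      have "complex_of_real t powr (z - 1) = exp ((- 1 / 2 + \<i> * s) * ln t)"
        using True by (simp add: powr_def z_def Ln_of_real)
      also have "\<dots> = iexp (s * ln t) * of_real (exp (- 1 / 2 * ln t))"
        by (simp add: exp_add [symmetric] algebra_simps exp_of_real [symmetric])
      also have "exp (- 1 / 2 * ln t) = t powr (- 1 / 2)"
        using True by (simp add: powr_def)
      finally show ?thesis using True by (simp add: f_def)
    qed simp
  qed
  have "(CLINT x|half_gamma. iexp (s * ln x)) =
     (CLINT t|lborel. (indicator {0<..} t * (t powr (- 1 / 2) / exp t) / sqrt pi) *\<^sub>R iexp (s * ln t))"
    unfolding half_gamma_def by (subst integral_density) auto
  also have "\<dots> = (CLINT t|lborel. indicator {0<..} t *\<^sub>R (iexp (s * ln t) * of_real (t powr (- 1 / 2) / exp t)) / sqrt pi)"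
    by (intro Bochner_Integration.integral_cong) (auto simp: indicator_def scaleR_conv_of_real)
  also have "\<dots> = (CLINT t|lborel. indicator {0<..} t *\<^sub>R (iexp (s * ln t) * of_real (t powr (- 1 / 2) / exp t))) / sqrt pi"
    by (rule integral_divide_zero)
  also have "(CLINT t|lborel. indicator {0<..} t *\<^sub>R (iexp (s * ln t) * of_real (t powr (- 1 / 2) / exp t)))
      = (CLINT t|lebesgue. indicator {0<..} t *\<^sub>R (iexp (s * ln t) * of_real (t powr (- 1 / 2) / exp t)))"
    by (subst integral_completion) auto
  also have "\<dots> = Gamma z"
    unfolding 2 1[symmetric] set_lebesgue_integral_def ..
  finally show ?thesis by (simp add: z_def)
qed

definition log_ratio :: "real \<Rightarrow> real measure" where
  "log_ratio c = distr (half_gamma \<Otimes>\<^sub>M half_gamma) borel (\<lambda>(x, y). c * (ln x - ln y))"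

interpretation half_gamma: prob_space half_gamma
  by (rule prob_space_half_gamma)

interpretation half_gamma_pair: pair_prob_space half_gamma half_gamma ..

lemma real_distribution_log_ratio: "real_distribution (log_ratio c)"
  unfolding log_ratio_def real_distribution_def real_distribution_axioms_def
  by (auto intro!: half_gamma_pair.prob_space_distr)

lemma char_log_ratio: "char (log_ratio c) u = 1 / cosh (pi * c * u)"
proof -
  define s where "s = u * c"
  have "char (log_ratio c) u = (CLINT z|half_gamma \<Otimes>\<^sub>M half_gamma. iexp (s * ln (fst z)) * iexp (- s * ln (snd z)))"
    unfolding char_def log_ratio_def
    by (subst integral_distr)
       (auto intro!: Bochner_Integration.integral_cong simp: s_def exp_add [symmetric] algebra_simps)
  also have "\<dots> = (CLINT x|half_gamma. CLINT y|half_gamma. iexp (s * ln x) * iexp (- s * ln y))"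
    by (subst half_gamma_pair.integral_fst' [symmetric])
       (auto intro!: half_gamma_pair.P.integrable_const_bound[where B = 1] simp: norm_mult)
  also have "\<dots> = (CLINT x|half_gamma. iexp (s * ln x)) * (CLINT y|half_gamma. iexp (- s * ln y))"
    by simp
  \<comment> \<open>The second argument \<open>1 / 2 - \<i> * s\<close> is put in reflected form;
    the \<open>pi\<close> from the two normalisations cancels the one in the reflection
    formula.\<close>
  also have "\<dots> = Gamma (1 / 2 + \<i> * s) * Gamma (1 - (1 / 2 + \<i> * s)) / pi"
    unfolding integral_half_gamma_iexp_ln by (simp flip: of_real_mult)
  also have "\<dots> = 1 / sin (pi * (1 / 2 + \<i> * s))"
    by (subst Gamma_reflection_complex) simp
  also have "pi * (1 / 2 + \<i> * s) = pi / 2 - \<i> * of_real (- pi * s)"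
    by (simp add: algebra_simps)
  also have "sin \<dots> = cos (\<i> * of_real (- pi * s))"
    unfolding sin_diff sin_of_real cos_of_real by simp
  also have "\<dots> = cosh (of_real (- pi * s))"
    by (simp add: cosh_conv_cos)
  also have "\<dots> = cosh (pi * c * u)"
    by (simp add: cosh_field_def s_def mult_ac flip: exp_of_real)
  finally show ?thesis by simp
qed

text \<open>If the first variable is at least 1 and the second at most
  \<open>d = exp (- x / c)\<close>, then the scaled log-ratio is at least \<open>x\<close>. The
  second event has probability of order \<open>sqrt d\<close>, which is
  \<open>exp (- x / (2 * c))\<close>.\<close>

lemma measure_log_ratio_ge:
  assumes "c > 0"
  shows "\<exists>C>0. \<forall>x\<ge>0. measure (log_ratio c) {y. x \<le> y} \<ge> C * exp (- x / (2 * c))"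
proof -
  define a where "a = measure half_gamma {1..}"
  \<comment> \<open>From \<open>x \<le> d \<le> 1\<close>, the density is at least
    \<open>exp (- 1) / sqrt pi / sqrt d\<close> on this interval; multiplied by the length
    \<open>d\<close>, this leaves \<open>sqrt d\<close>.\<close>
  have small: "emeasure half_gamma {0<..d} \<ge> ennreal (exp (- 1) / sqrt pi * sqrt d)"
    if d: "0 < d" "d \<le> 1" for d
  proof -
    have "ennreal (exp (- 1) / sqrt pi * sqrt d) =
        (\<integral>\<^sup>+x. ennreal (exp (- 1) / sqrt pi / sqrt d) * indicator {0<..d} x \<partial>lborel)"
      using d by (subst nn_integral_cmult_indicator)
        (auto simp: ennreal_mult' [symmetric] real_div_sqrt field_simps)
    also have "\<dots> \<le> (\<integral>\<^sup>+x. ennreal (indicator {0<..} x * (x powr (- 1 / 2) / exp x) / sqrt pi) * indicator {0<..d} x \<partial>lborel)"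
    proof (intro nn_integral_mono)
      fix x :: real
      show "ennreal (exp (- 1) / sqrt pi / sqrt d) * indicator {0<..d} x
        \<le> ennreal (indicator {0<..} x * (x powr (- 1 / 2) / exp x) / sqrt pi) * indicator {0<..d} x"
      proof (cases "x \<in> {0<..d}")
        case True
        have "exp (- 1) * (1 / sqrt d) \<le> exp (- x) * (1 / sqrt x)"
          using True d by (intro mult_mono) (auto intro!: divide_left_mono)
        moreover have "x powr (- 1 / 2) = 1 / sqrt x"
          using True by (simp add: powr_minus_divide powr_half_sqrt)
        ultimately have "exp (- 1) * (1 / sqrt d) \<le> x powr (- 1 / 2) / exp x"
          by (simp only: exp_minus[of x]) (simp add: field_simps)
        from divide_right_mono[OF this, of "sqrt pi"]
        have "exp (- 1) / sqrt pi / sqrt d \<le> (x powr (- 1 / 2) / exp x) / sqrt pi"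
          by (simp add: mult.commute)
        then show ?thesis using True by (auto intro!: ennreal_leI)
      qed simp
    qed
    also have "\<dots> = emeasure half_gamma {0<..d}"
      unfolding half_gamma_def by (subst emeasure_density) auto
    finally show ?thesis .
  qed
  have "a > 0"
  proof -
    have "a \<noteq> 0"
    proof
      assume "a = 0"
      then have "AE x in half_gamma. x \<notin> {1..}"
        by (subst (asm) a_def, intro AE_not_in)
           (auto simp: null_sets_def half_gamma.emeasure_eq_measure)
      then have "AE x in lborel. (x::real) \<le> 0 \<or> x < 1"
        unfolding half_gamma_def by (subst (asm) AE_density) (auto simp: indicator_def)
      then have "emeasure lborel {x::real. \<not> (x \<le> 0 \<or> x < 1)} = 0"
        by (subst (asm) AE_iff_measurable[OF _ refl]) auto
      moreover have "emeasure lborel {1..2::real} \<le> emeasure lborel {x::real. \<not> (x \<le> 0 \<or> x < 1)}"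
        by (intro emeasure_mono) auto
      ultimately show False by simp
    qed
    then show ?thesis by (simp add: a_def zero_less_measure_iff)
  qed
  show ?thesis
  proof (intro exI[of _ "a * (exp (- 1) / sqrt pi)"] conjI allI impI)
    show "a * (exp (- 1) / sqrt pi) > 0" using \<open>a > 0\<close> by simp
    fix x :: real assume "x \<ge> 0"
    define d where "d = exp (- x / c)"
    have d: "0 < d" "d \<le> 1" using \<open>x \<ge> 0\<close> \<open>c > 0\<close> by (auto simp: d_def)
    have "sqrt d = exp (- x / (2 * c))"
      by (rule real_sqrt_unique) (auto simp: d_def power2_eq_square exp_add [symmetric])
    then have "a * (exp (- 1) / sqrt pi) * exp (- x / (2 * c)) \<le> a * measure half_gamma {0<..d}"
      using small[OF d] \<open>a > 0\<close> d
        mult_left_mono[of "exp (- 1) / sqrt pi * sqrt d" "measure half_gamma {0<..d}" a]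
      by (simp add: half_gamma.emeasure_eq_measure mult.assoc)
    also have "\<dots> = measure (half_gamma \<Otimes>\<^sub>M half_gamma) ({1..} \<times> {0<..d})"
      unfolding a_def measure_def by (subst half_gamma.emeasure_pair_measure_Times) (auto simp: enn2real_mult)
    also have "\<dots> \<le> measure (half_gamma \<Otimes>\<^sub>M half_gamma) {z. x \<le> c * (ln (fst z) - ln (snd z))}"
    proof (rule half_gamma_pair.P.finite_measure_mono)
      show "{1..} \<times> {0<..d} \<subseteq> {z. x \<le> c * (ln (fst z) - ln (snd z))}"
      proof clarsimp
        fix u v :: real assume "1 \<le> u" "0 < v" "v \<le> d"
        then have "ln u \<ge> 0" "ln v \<le> - x / c"
          using d by (auto simp: d_def ln_ge_iff ln_le_cancel_iff[symmetric] simp del: ln_le_cancel_iff)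
        then have "c * (x / c) \<le> c * (ln u - ln v)"
          using \<open>c > 0\<close> by (intro mult_left_mono) auto
        then show "x \<le> c * (ln u - ln v)" using \<open>c > 0\<close> by simp
      qed
      have "{z \<in> space (half_gamma \<Otimes>\<^sub>M half_gamma). x \<le> c * (ln (fst z) - ln (snd z))} \<in> sets (half_gamma \<Otimes>\<^sub>M half_gamma)"
        by measurable
      then show "{z. x \<le> c * (ln (fst z) - ln (snd z))} \<in> sets (half_gamma \<Otimes>\<^sub>M half_gamma)"
        by (simp add: space_pair_measure)
    qed
    also have "\<dots> = measure (log_ratio c) {y. x \<le> y}"
      unfolding log_ratio_def
      by (subst measure_distr) (auto simp: space_pair_measure intro!: arg_cong2[where f = measure])
    finally show "a * (exp (- 1) / sqrt pi) * exp (- x / (2 * c)) \<le> measure (log_ratio c) {y. x \<le> y}" .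
  qed
qed

text \<open>The integrand is \<open>x powr (l * c) * y powr (- l * c)\<close>, so the integral is a
  product of two Gamma moments; the hypothesis puts both orders above -1/2.\<close>

lemma nn_integral_log_ratio_exp_finite:
  assumes "\<bar>l * c\<bar> < 1 / 2"
  shows "(\<integral>\<^sup>+y. ennreal (exp (l * y)) \<partial>log_ratio c) < \<infinity>"
proof -
  have "(\<integral>\<^sup>+y. ennreal (exp (l * y)) \<partial>log_ratio c) =
      (\<integral>\<^sup>+x. \<integral>\<^sup>+y. ennreal (exp (l * (c * (ln x - ln y)))) \<partial>half_gamma \<partial>half_gamma)"
    unfolding log_ratio_def
    by (subst nn_integral_distr) (auto simp: half_gamma.nn_integral_fst [symmetric] split_beta')
  also have "\<dots> = (\<integral>\<^sup>+x. \<integral>\<^sup>+y. ennreal (x powr (l * c)) * ennreal (y powr (- l * c)) \<partial>half_gamma \<partial>half_gamma)"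
  proof (rule nn_integral_cong_AE, use AE_half_gamma_pos in eventually_elim)
    fix x :: real assume x: "x > 0"
    show "(\<integral>\<^sup>+y. ennreal (exp (l * (c * (ln x - ln y)))) \<partial>half_gamma) =
      (\<integral>\<^sup>+y. ennreal (x powr (l * c)) * ennreal (y powr (- l * c)) \<partial>half_gamma)"
      by (rule nn_integral_cong_AE, use AE_half_gamma_pos in eventually_elim)
         (use x in \<open>simp add: ennreal_mult' [symmetric] powr_def exp_add [symmetric] algebra_simps\<close>)
  qed
  also have "\<dots> = (\<integral>\<^sup>+x. ennreal (x powr (l * c)) \<partial>half_gamma) * (\<integral>\<^sup>+y. ennreal (y powr (- l * c)) \<partial>half_gamma)"
    by (simp add: nn_integral_cmult nn_integral_multc)
  also have "\<dots> < \<infinity>"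
    using assms by (subst (1 2) nn_integral_half_gamma_powr) (auto simp: ennreal_mult_less_top)
  finally show ?thesis .
qed

lemma nn_integral_log_ratio_exp_abs_finite:
  assumes "c > 0" "l < 1 / (2 * c)" "l \<ge> 0"
  shows "(\<integral>\<^sup>+y. ennreal (exp (l * \<bar>y\<bar>)) \<partial>log_ratio c) < \<infinity>"
proof -
  have "\<bar>l * c\<bar> < 1 / 2" using assms by (simp add: field_simps)
  have "(\<integral>\<^sup>+y. ennreal (exp (l * \<bar>y\<bar>)) \<partial>log_ratio c) \<le>
     (\<integral>\<^sup>+y. ennreal (exp (l * y)) + ennreal (exp (- l * y)) \<partial>log_ratio c)"
    by (intro nn_integral_mono) (auto simp: ennreal_plus [symmetric] abs_if simp del: ennreal_plus intro!: ennreal_leI)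
  also have "\<dots> = (\<integral>\<^sup>+y. ennreal (exp (l * y)) \<partial>log_ratio c) + (\<integral>\<^sup>+y. ennreal (exp (- l * y)) \<partial>log_ratio c)"
    by (intro nn_integral_add) (auto simp: log_ratio_def)
  also have "\<dots> < \<infinity>"
    using nn_integral_log_ratio_exp_finite[of l c] nn_integral_log_ratio_exp_finite[of "- l" c] \<open>\<bar>l * c\<bar> < 1 / 2\<close>
    by (simp add: ennreal_add_less_top)
  finally show ?thesis .
qed

subsection \<open>Gaussian integrals and Brownian increments\<close>

lemma char_normal_density:
  assumes "\<tau> > 0"
  shows "(CLINT x|lborel. normal_density \<mu> \<tau> x *\<^sub>R iexp (v * x)) = of_real (exp (- (v\<^sup>2 * \<tau>\<^sup>2) / 2)) * iexp (v * \<mu>)"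
proof -
  have nd: "\<tau> * normal_density \<mu> \<tau> (\<mu> + \<tau> * y) = std_normal_density y" for y
    using assms by (simp add: normal_density_def real_sqrt_mult power_mult_distrib)
  have "(CLINT x|lborel. normal_density \<mu> \<tau> x *\<^sub>R iexp (v * x)) =
     \<tau> *\<^sub>R (CLINT y|lborel. normal_density \<mu> \<tau> (\<mu> + \<tau> * y) *\<^sub>R iexp (v * (\<mu> + \<tau> * y)))"
    using assms by (subst lborel_integral_real_affine[of \<tau> _ \<mu>]) auto
  also have "\<dots> = (CLINT y|lborel. std_normal_density y *\<^sub>R iexp ((v * \<tau>) * y) * iexp (v * \<mu>))"
    by (subst integral_scaleR_right [symmetric])
       (auto intro!: Bochner_Integration.integral_cong simp: exp_add [symmetric] algebra_simps simp flip: nd)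
  also have "\<dots> = (CLINT y|lborel. std_normal_density y *\<^sub>R iexp ((v * \<tau>) * y)) * iexp (v * \<mu>)"
    by (rule integral_mult_left_zero)
  also have "(CLINT y|lborel. std_normal_density y *\<^sub>R iexp ((v * \<tau>) * y)) = char std_normal_distribution (v * \<tau>)"
    unfolding char_def by (subst integral_density) auto
  finally show ?thesis
    by (simp add: char_std_normal_distribution power_mult_distrib)
qed

text \<open>Completing the square: the weight moves the mean towards \<open>- b\<close> and shrinks
  the variance from \<open>h\<close> to \<open>h / D\<close>; renormalising the density produces
  \<open>1 / sqrt D\<close>.\<close>

lemma gaussian_tilt:
  assumes "h > 0" "\<beta> \<ge> 0"
  defines "D \<equiv> 1 + \<beta> * h"
  shows "normal_density 0 (sqrt h) x * exp (- \<beta> * (b + x)\<^sup>2 / 2) =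
    exp (- \<beta> * b\<^sup>2 / (2 * D)) / sqrt D * normal_density (- \<beta> * b * h / D) (sqrt (h / D)) x"
proof -
  have "D > 0" using assms by (simp add: D_def add_pos_nonneg)
  have "- x\<^sup>2 / (2 * h) + - \<beta> * (b + x)\<^sup>2 / 2 =
      - \<beta> * b\<^sup>2 / (2 * D) + - (x + \<beta> * b * h / D)\<^sup>2 / (2 * (h / D))"
    using \<open>D > 0\<close> \<open>h > 0\<close>
    by (simp add: field_simps) (simp add: D_def power2_eq_square algebra_simps)
  then have "exp (- x\<^sup>2 / (2 * h)) * exp (- \<beta> * (b + x)\<^sup>2 / 2) =
      exp (- \<beta> * b\<^sup>2 / (2 * D)) * exp (- (x + \<beta> * b * h / D)\<^sup>2 / (2 * (h / D)))"
    by (simp only: exp_add [symmetric])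
  moreover have "sqrt (2 * pi * (h / D)) * sqrt D = sqrt (2 * pi * h)"
    using \<open>D > 0\<close> by (simp flip: real_sqrt_mult)
  ultimately show ?thesis
    using \<open>D > 0\<close> \<open>h > 0\<close> by (simp add: normal_density_def field_simps)
qed

text \<open>This handles one coordinate of an increment: \<open>b\<close> is the current position,
  \<open>\<beta>\<close> the weight on the next one and \<open>v\<close> the slope of the phase.
  After the tilt, the variance of the normal law contributes \<open>v\<^sup>2 * h\<close> to the
  exponent and its mean contributes the phase.\<close>

lemma gaussian_weighted_char:
  assumes "h > 0" "\<beta> \<ge> 0"
  defines "D \<equiv> 1 + \<beta> * h"
  shows "(CLINT x|density lborel (normal_density 0 (sqrt h)). of_real (exp (- \<beta> * (b + x)\<^sup>2 / 2)) * iexp (v * x)) =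
    of_real (exp (- (\<beta> * b\<^sup>2 + v\<^sup>2 * h) / (2 * D)) / sqrt D) * iexp (- (v * b * (\<beta> * h / D)))"
proof -
  have "D > 0" using assms by (simp add: D_def add_pos_nonneg)
  have "(CLINT x|density lborel (normal_density 0 (sqrt h)). of_real (exp (- \<beta> * (b + x)\<^sup>2 / 2)) * iexp (v * x)) =
     (CLINT x|lborel. (normal_density 0 (sqrt h) x * exp (- \<beta> * (b + x)\<^sup>2 / 2)) *\<^sub>R iexp (v * x))"
    by (subst integral_density) (auto simp: scaleR_conv_of_real mult.assoc)
  also have "\<dots> = (CLINT x|lborel. of_real (exp (- \<beta> * b\<^sup>2 / (2 * D)) / sqrt D) *
      (normal_density (- \<beta> * b * h / D) (sqrt (h / D)) x *\<^sub>R iexp (v * x)))"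
    unfolding gaussian_tilt[OF assms(1,2)] D_def[symmetric]
    by (simp add: scaleR_conv_of_real mult.assoc)
  also have "\<dots> = of_real (exp (- \<beta> * b\<^sup>2 / (2 * D)) / sqrt D) *
     (of_real (exp (- (v\<^sup>2 * (sqrt (h / D))\<^sup>2) / 2)) * iexp (v * (- \<beta> * b * h / D)))"
    using \<open>D > 0\<close> \<open>h > 0\<close> by (simp only: integral_mult_right_zero) (subst char_normal_density, auto)
  also have "exp (- (v\<^sup>2 * (sqrt (h / D))\<^sup>2) / 2) = exp (- (v\<^sup>2 * h / (2 * D)))"
    using \<open>D > 0\<close> \<open>h > 0\<close> by (simp add: field_simps)
  also have "of_real (exp (- \<beta> * b\<^sup>2 / (2 * D)) / sqrt D) * (of_real (exp (- (v\<^sup>2 * h / (2 * D)))) * iexp (v * (- \<beta> * b * h / D)))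
      = of_real (exp (- \<beta> * b\<^sup>2 / (2 * D)) * exp (- (v\<^sup>2 * h / (2 * D))) / sqrt D) * iexp (v * (- \<beta> * b * h / D))"
    by simp
  also have "exp (- \<beta> * b\<^sup>2 / (2 * D)) * exp (- (v\<^sup>2 * h / (2 * D))) = exp (- (\<beta> * b\<^sup>2 + v\<^sup>2 * h) / (2 * D))"
    by (simp add: exp_add [symmetric] diff_divide_distrib)
  also have "v * (- \<beta> * b * h / D) = - (v * b * (\<beta> * h / D))"
    by simp
  finally show ?thesis .
qed

text \<open>Turns the vector density from the definition of Brownian motion into a product measure,
  over which Fubini integrates the coordinates separately. It suffices to compare rectangles, where
  Lebesgue measure factors over \<open>Basis\<close>.\<close>

lemma distr_product_density_normal_real2:
  assumes "\<sigma> > 0"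
  shows "distr (density lborel (\<lambda>x::real^2. ennreal (\<Prod>i\<in>UNIV. normal_density 0 \<sigma> (x $ i))))
      (borel \<Otimes>\<^sub>M borel) (\<lambda>x. (x $ 1, x $ 2)) =
    density lborel (normal_density 0 \<sigma>) \<Otimes>\<^sub>M density lborel (normal_density 0 \<sigma>)"
    (is "distr ?G _ ?f = ?N \<Otimes>\<^sub>M ?N")
proof (rule pair_measure_eqI [symmetric])
  interpret prob_space ?N
    using assms by (rule prob_space_normal_density)
  show "sigma_finite_measure ?N" by unfold_locales
  show "sigma_finite_measure ?N" by unfold_locales
  show "sets (?N \<Otimes>\<^sub>M ?N) = sets (distr ?G (borel \<Otimes>\<^sub>M borel) ?f)"
    by (auto intro!: sets_pair_measure_cong)
  fix A B :: "real set" assume "A \<in> sets ?N" "B \<in> sets ?N"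
  then have [measurable]: "A \<in> sets borel" "B \<in> sets borel" by auto
  \<comment> \<open>Assigns to each basis vector the side of the rectangle in its direction, as the
    product formula over \<open>Basis\<close> requires.\<close>
  define C where "C = (\<lambda>b::real^2. if b = axis 1 1 then A else B)"
  have [measurable]: "C b \<in> sets borel" for b by (simp add: C_def)
  have ne: "axis 1 1 \<noteq> (axis 2 1 :: real^2)" by (simp add: axis_eq_axis)
  have Basis: "(Basis :: (real^2) set) = {axis 1 1, axis 2 1}"
    by (auto simp: Basis_vec_def UNIV_2)
  have "emeasure (distr ?G (borel \<Otimes>\<^sub>M borel) ?f) (A \<times> B) = emeasure ?G (?f -` (A \<times> B) \<inter> space ?G)"
    by (subst emeasure_distr) auto
  also have "\<dots> = (\<integral>\<^sup>+x. ennreal (\<Prod>i\<in>UNIV. normal_density 0 \<sigma> (x $ i)) * indicator (?f -` (A \<times> B) \<inter> space ?G) x \<partial>lborel)"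
  proof (subst emeasure_density)
    have "?f -` (A \<times> B) \<inter> space (borel :: (real^2) measure) \<in> sets borel"
      by (rule measurable_sets[of _ _ "borel \<Otimes>\<^sub>M borel"]) auto
    then show "?f -` (A \<times> B) \<inter> space ?G \<in> sets lborel" by simp
  qed auto
  also have "\<dots> = (\<integral>\<^sup>+x. (\<Prod>b\<in>Basis. (\<lambda>y. ennreal (normal_density 0 \<sigma> y) * indicator (C b) y) (x \<bullet> b)) \<partial>lborel)"
    using ne by (intro nn_integral_cong)
      (auto simp: Basis C_def inner_axis UNIV_2 ennreal_mult' indicator_def)
  also have "\<dots> = (\<Prod>b\<in>Basis. \<integral>\<^sup>+y. ennreal (normal_density 0 \<sigma> y) * indicator (C b) y \<partial>lborel)"
    by (rule nn_integral_lborel_prod) auto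
  also have "\<dots> = emeasure ?N A * emeasure ?N B"
    using ne by (simp add: Basis C_def emeasure_density)
  finally show "emeasure ?N A * emeasure ?N B = emeasure (distr ?G (borel \<Otimes>\<^sub>M borel) ?f) (A \<times> B)" ..
qed

section \<open>Adapted variables and increments of planar Brownian motion\<close>

locale brownian_plane = prob_space M for M :: "'a measure" +
  fixes B :: "real \<Rightarrow> 'a \<Rightarrow> real ^ 2"
  assumes brownian: "brownian_motion M B"
begin

abbreviation F :: "real \<Rightarrow> 'a measure" where
  "F \<equiv> natural_filtration M B"

lemma measurable_B [measurable]: "t \<ge> 0 \<Longrightarrow> B t \<in> borel_measurable M"
  using brownian by (auto simp: brownian_motion_def)

lemma measurable_B_nth [measurable]: "t \<ge> 0 \<Longrightarrow> (\<lambda>\<omega>. B t \<omega> $ i) \<in> borel_measurable M"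
  by (rule measurable_compose[OF measurable_B]) auto

lemma AE_B_0: "AE \<omega> in M. B 0 \<omega> = 0"
  using brownian by (auto simp: brownian_motion_def)

lemma space_F [simp]: "space (F t) = space M"
  by (simp add: natural_filtration_def space_measure_of_conv)

lemma sets_F: "sets (F t) = sigma_sets (space M) {B s -` A \<inter> space M | s A. 0 \<le> s \<and> s \<le> t \<and> A \<in> sets borel}"
  unfolding natural_filtration_def by (rule sets_measure_of) auto

lemma sets_F_mono: "s \<le> t \<Longrightarrow> sets (F s) \<subseteq> sets (F t)"
  unfolding sets_F by (rule sigma_sets_mono') (blast intro: order_trans)

lemma sets_F_subset: "sets (F t) \<subseteq> sets M"
  unfolding sets_F by (rule sets.sigma_sets_subset) auto

lemma measurable_F_mono: "X \<in> measurable (F s) L \<Longrightarrow> s \<le> t \<Longrightarrow> X \<in> measurable (F t) L"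
  using sets_F_mono[of s t] by (auto simp: measurable_def)

lemma measurable_F_imp: "X \<in> measurable (F s) L \<Longrightarrow> X \<in> measurable M L"
  using sets_F_subset[of s] by (auto simp: measurable_def)

lemma B_measurable_F: "0 \<le> s \<Longrightarrow> s \<le> t \<Longrightarrow> B s \<in> borel_measurable (F t)"
  by (intro measurableI) (auto simp: sets_F intro!: sigma_sets.Basic)

lemma indep_set_increment:
  assumes "0 \<le> s" "s < t"
  shows "indep_set (sets (F s)) {(\<lambda>\<omega>. B t \<omega> - B s \<omega>) -` A \<inter> space M | A. A \<in> sets borel}"
  using brownian assms by (auto simp: brownian_motion_def)

text \<open>Independence of the past from the increment is inherited by sub-sigma-algebras:
  \<open>X\<close> generates one inside \<open>F s\<close>, and a function of the increment one
  inside the preimage algebra.\<close>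

lemma indep_increment:
  assumes X: "X \<in> measurable (F s) L" and st: "0 \<le> s" "s < t" and f: "f \<in> measurable borel L'"
  shows "indep_var L X L' (\<lambda>\<omega>. f (B t \<omega> - B s \<omega>))"
proof -
  let ?I = "{(\<lambda>\<omega>. B t \<omega> - B s \<omega>) -` A \<inter> space M | A. A \<in> sets borel}"
  have [measurable]: "B s \<in> borel_measurable M" "B t \<in> borel_measurable M" using st by auto
  \<comment> \<open>The preimages of Borel sets already form a sigma-algebra, so closing the smaller
    family under \<open>sigma_sets\<close> stays inside it.\<close>
  have I: "?I = sets (vimage_algebra (space M) (\<lambda>\<omega>. B t \<omega> - B s \<omega>) borel)"
    by (subst sets_vimage_algebra2) auto
  have sub: "sigma_sets (space M) A \<subseteq> sets N" if "A \<subseteq> sets N" "space N = space M" for A and N :: "'a measure"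
    using sets.sigma_sets_subset[of A N] that by simp
  have "{X -` A \<inter> space M | A. A \<in> sets L} \<subseteq> sets (F s)"
    using measurable_sets[OF X] by auto
  then have 1: "sigma_sets (space M) {X -` A \<inter> space M | A. A \<in> sets L} \<subseteq> sets (F s)"
    by (rule sub) simp
  have "(\<lambda>\<omega>. f (B t \<omega> - B s \<omega>)) \<in> measurable (vimage_algebra (space M) (\<lambda>\<omega>. B t \<omega> - B s \<omega>) borel) L'"
    by (rule measurable_compose[OF measurable_vimage_algebra1 f]) auto
  from measurable_sets[OF this]
  have "{(\<lambda>\<omega>. f (B t \<omega> - B s \<omega>)) -` A \<inter> space M | A. A \<in> sets L'} \<subseteq> ?I"
    unfolding I by auto
  then have 2: "sigma_sets (space M) {(\<lambda>\<omega>. f (B t \<omega> - B s \<omega>)) -` A \<inter> space M | A. A \<in> sets L'} \<subseteq> ?I"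
    unfolding I by (rule sub) simp
  have "indep_set (sigma_sets (space M) {X -` A \<inter> space M | A. A \<in> sets L})
     (sigma_sets (space M) {(\<lambda>\<omega>. f (B t \<omega> - B s \<omega>)) -` A \<inter> space M | A. A \<in> sets L'})"
    using indep_set_increment[OF st] unfolding indep_set_def
    by (rule indep_sets_mono_sets) (use 1 2 in \<open>auto split: bool.split\<close>)
  moreover have "(\<lambda>\<omega>. f (B t \<omega> - B s \<omega>)) \<in> measurable M L'"
    by (rule measurable_compose[OF _ f]) measurable
  ultimately show ?thesis
    unfolding indep_var_eq using measurable_F_imp[OF X] by auto
qed

lemma distr_increment:
  assumes "0 \<le> s" "s < t"
  shows "distr M borel (\<lambda>\<omega>. B t \<omega> - B s \<omega>) =
    density lborel (\<lambda>x. ennreal (\<Prod>i\<in>UNIV. normal_density 0 (sqrt (t - s)) (x $ i)))"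
proof -
  have "distr M lborel (\<lambda>\<omega>. B t \<omega> - B s \<omega>) =
    density lborel (\<lambda>x. ennreal (\<Prod>i\<in>UNIV. normal_density 0 (sqrt (t - s)) (x $ i)))"
    using brownian assms by (auto simp: brownian_motion_def distributed_def)
  then show ?thesis by (subst (asm) distr_cong[where N = lborel and K = M]) (auto cong: distr_cong)
qed

lemma distr_increment_pair:
  assumes "0 \<le> s" "s < t"
  shows "distr M (borel \<Otimes>\<^sub>M borel) (\<lambda>\<omega>. (B t \<omega> $ 1 - B s \<omega> $ 1, B t \<omega> $ 2 - B s \<omega> $ 2)) =
    density lborel (normal_density 0 (sqrt (t - s))) \<Otimes>\<^sub>M density lborel (normal_density 0 (sqrt (t - s)))"
proof -
  have [measurable]: "B s \<in> borel_measurable M" "B t \<in> borel_measurable M" using assms by auto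
  have "distr M (borel \<Otimes>\<^sub>M borel) (\<lambda>\<omega>. (B t \<omega> $ 1 - B s \<omega> $ 1, B t \<omega> $ 2 - B s \<omega> $ 2)) =
    distr (distr M borel (\<lambda>\<omega>. B t \<omega> - B s \<omega>)) (borel \<Otimes>\<^sub>M borel) (\<lambda>x. (x $ 1, x $ 2))"
    by (subst distr_distr) (auto simp: comp_def)
  then show ?thesis
    using assms by (simp add: distr_increment distr_product_density_normal_real2)
qed

lemma distributed_increment:
  assumes "0 \<le> s" "s < t"
  shows "distributed M lborel (\<lambda>\<omega>. B t \<omega> $ i - B s \<omega> $ i) (normal_density 0 (sqrt (t - s)))"
proof -
  let ?N = "density lborel (normal_density 0 (sqrt (t - s)))"
  have [measurable]: "(\<lambda>\<omega>. B s \<omega> $ j) \<in> borel_measurable M" "(\<lambda>\<omega>. B t \<omega> $ j) \<in> borel_measurable M" for j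
    using assms by auto
  interpret N: prob_space ?N using assms by (intro prob_space_normal_density) auto
  interpret NN: pair_prob_space ?N ?N ..
  have "distr M borel (\<lambda>\<omega>. B t \<omega> $ 1 - B s \<omega> $ 1) = distr (?N \<Otimes>\<^sub>M ?N) borel fst"
    unfolding distr_increment_pair[OF assms, symmetric] by (subst distr_distr) (auto simp: comp_def)
  moreover have "distr (?N \<Otimes>\<^sub>M ?N) ?N fst = ?N"
    by (rule N.distr_pair_fst)
  moreover have "distr M borel (\<lambda>\<omega>. B t \<omega> $ 2 - B s \<omega> $ 2) = distr (?N \<Otimes>\<^sub>M ?N) borel snd"
    unfolding distr_increment_pair[OF assms, symmetric] by (subst distr_distr) (auto simp: comp_def)
  moreover have "distr (?N \<Otimes>\<^sub>M ?N) ?N snd = ?N"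
    by (subst NN.distr_pair_swap, subst distr_distr) (auto simp: comp_def split_beta' N.distr_pair_fst)
  moreover have "distr (?N \<Otimes>\<^sub>M ?N) ?N fst = distr (?N \<Otimes>\<^sub>M ?N) borel fst" "distr (?N \<Otimes>\<^sub>M ?N) ?N snd = distr (?N \<Otimes>\<^sub>M ?N) borel snd"
    by (auto intro!: distr_cong)
  moreover have "i = 1 \<or> i = 2" using exhaust_2 by auto
  ultimately have "distr M borel (\<lambda>\<omega>. B t \<omega> $ i - B s \<omega> $ i) = ?N" by auto
  moreover have "distr M borel (\<lambda>\<omega>. B t \<omega> $ i - B s \<omega> $ i) = distr M lborel (\<lambda>\<omega>. B t \<omega> $ i - B s \<omega> $ i)"
    by (auto intro!: distr_cong)
  ultimately show ?thesis by (simp add: distributed_def)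
qed

end

subsection \<open>Ito isometry\<close>

lemma integrable_mult_square_integrable:
  fixes f g :: "'a \<Rightarrow> real"
  assumes [measurable]: "f \<in> borel_measurable M" "g \<in> borel_measurable M"
    and "integrable M (\<lambda>x. (f x)\<^sup>2)" "integrable M (\<lambda>x. (g x)\<^sup>2)"
  shows "integrable M (\<lambda>x. f x * g x)"
proof (rule Bochner_Integration.integrable_bound)
  show "integrable M (\<lambda>x. (f x)\<^sup>2 + (g x)\<^sup>2)" using assms by simp
  have "\<bar>u * v\<bar> \<le> u\<^sup>2 + v\<^sup>2" for u v :: real
  proof -
    have "0 \<le> \<bar>u\<bar> * \<bar>v\<bar>" by simp
    then show ?thesis
      using sum_squares_bound[of "\<bar>u\<bar>" "\<bar>v\<bar>"] unfolding abs_mult power2_abs by linarith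
  qed
  then show "AE x in M. norm (f x * g x) \<le> norm ((f x)\<^sup>2 + (g x)\<^sup>2)" by simp
qed simp

lemma has_bochner_integral_pair_mult:
  fixes f :: "'a \<Rightarrow> real" and g :: "'b \<Rightarrow> real"
  assumes "sigma_finite_measure M" "sigma_finite_measure L" "integrable M f" "integrable L g"
  shows "has_bochner_integral (M \<Otimes>\<^sub>M L) (\<lambda>(x, y). f x * g y) ((\<integral>x. f x \<partial>M) * (\<integral>y. g y \<partial>L))"
proof -
  interpret M: sigma_finite_measure M by fact
  interpret L: sigma_finite_measure L by fact
  interpret pair_sigma_finite M L ..
  have [measurable]: "f \<in> borel_measurable M" "g \<in> borel_measurable L" using assms by auto
  have i: "integrable (M \<Otimes>\<^sub>M L) (\<lambda>(x, y). f x * g y)"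
    using assms by (intro Fubini_integrable) (auto simp: abs_mult)
  moreover from integral_fst[OF i] have "(\<integral>z. (\<lambda>(x, y). f x * g y) z \<partial>(M \<Otimes>\<^sub>M L)) = (\<integral>x. f x \<partial>M) * (\<integral>y. g y \<partial>L)"
    by simp
  ultimately show ?thesis by (simp add: has_bochner_integral_iff)
qed

context brownian_plane
begin

lemma increment_square_integrable:
  assumes "0 \<le> s" "s \<le> t"
  shows "has_bochner_integral M (\<lambda>\<omega>. (B t \<omega> $ i - B s \<omega> $ i)\<^sup>2) (t - s)"
proof (cases "s = t")
  case False
  with assms have st: "0 \<le> s" "s < t" by auto
  note D = distributed_increment[OF st, of i]
  have "0 < sqrt (t - s)" using st by simp
  from normal_moment_even[OF this, of 0 1] st
  have "has_bochner_integral lborel (\<lambda>x. normal_density 0 (sqrt (t - s)) x * x\<^sup>2) (t - s)"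
    by (simp add: fact_2 diff_divide_distrib)
  then show ?thesis
    using distributed_integrable[OF D, of "\<lambda>x. x\<^sup>2"] distributed_integral[OF D, of "\<lambda>x. x\<^sup>2"]
    by (simp add: has_bochner_integral_iff)
qed (simp add: has_bochner_integral_zero)

lemma increment_integrable:
  assumes "0 \<le> s" "s \<le> t"
  shows "has_bochner_integral M (\<lambda>\<omega>. B t \<omega> $ i - B s \<omega> $ i) 0"
proof (cases "s = t")
  case False
  with assms have st: "0 \<le> s" "s < t" by auto
  note D = distributed_increment[OF st, of i]
  have "0 < sqrt (t - s)" using st by simp
  from normal_moment_nz_1[OF this, of 0]
  show ?thesis
    using distributed_integrable[OF D, of "\<lambda>x. x"] distributed_integral[OF D, of "\<lambda>x. x"]
    by (simp add: has_bochner_integral_iff)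
qed (simp add: has_bochner_integral_zero)

lemma indep_increment_component:
  assumes "X \<in> borel_measurable (F s)" "0 \<le> s" "s < t" "f \<in> borel_measurable borel"
  shows "indep_var borel X borel (\<lambda>\<omega>. f (B t \<omega> $ i - B s \<omega> $ i))"
proof -
  have "(\<lambda>x::real^2. f (x $ i)) \<in> borel_measurable borel"
    using assms(4) by (rule measurable_compose[rotated]) simp
  from indep_increment[OF assms(1-3) this] show ?thesis by simp
qed

text \<open>The martingale property in integrated form: by independence the expectation factors, and
  the increment is centred. The case \<open>s = t\<close> is separate because the Gaussian density
  is prescribed only for \<open>s < t\<close>.\<close>

lemma adapted_mult_increment:
  assumes X: "X \<in> borel_measurable (F s)" "integrable M X" and st: "0 \<le> s" "s \<le> t"
  shows "has_bochner_integral M (\<lambda>\<omega>. X \<omega> * (B t \<omega> $ i - B s \<omega> $ i)) 0"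
proof (cases "s = t")
  case False
  then have iv: "indep_var borel X borel (\<lambda>\<omega>. B t \<omega> $ i - B s \<omega> $ i)"
    using indep_increment_component[of X s t "\<lambda>x. x"] X st by simp
  show ?thesis
    using indep_var_lebesgue_integral[OF iv X(2)] indep_var_integrable[OF iv X(2)]
      increment_integrable[OF st, of i]
    by (simp add: has_bochner_integral_iff)
qed (simp add: has_bochner_integral_zero)

lemma adapted_mult_increment_square:
  assumes X: "X \<in> borel_measurable (F s)" "integrable M X" and st: "0 \<le> s" "s \<le> t"
  shows "has_bochner_integral M (\<lambda>\<omega>. X \<omega> * (B t \<omega> $ i - B s \<omega> $ i)\<^sup>2) (expectation X * (t - s))"
proof (cases "s = t")
  case False
  then have iv: "indep_var borel X borel (\<lambda>\<omega>. (B t \<omega> $ i - B s \<omega> $ i)\<^sup>2)"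
    using indep_increment_component[of X s t "\<lambda>x. x\<^sup>2"] X st by simp
  show ?thesis
    using indep_var_lebesgue_integral[OF iv X(2)] indep_var_integrable[OF iv X(2)]
      increment_square_integrable[OF st, of i]
    by (simp add: has_bochner_integral_iff)
qed (simp add: has_bochner_integral_zero)

lemma B_nth_measurable_F [measurable (raw)]:
  "0 \<le> s \<Longrightarrow> s \<le> t \<Longrightarrow> (\<lambda>\<omega>. B s \<omega> $ i) \<in> borel_measurable (F t)"
  by (rule measurable_compose[OF B_measurable_F]) auto

text \<open>Both increments are cut at the endpoints. The part of the first one before
  \<open>c\<close> is known at time \<open>c\<close> and pairs to zero with the second; on the
  overlap a square remains, whose mean is the length; what follows the overlap pairs to zero with
  it.\<close>

lemma increment_product_expectation_ordered:
  assumes X: "X \<in> borel_measurable (F a)" "integrable M (\<lambda>\<omega>. (X \<omega>)\<^sup>2)"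
    and Y: "Y \<in> borel_measurable (F c)" "integrable M (\<lambda>\<omega>. (Y \<omega>)\<^sup>2)"
    and ac: "0 \<le> a" "a \<le> b" "a \<le> c" "c \<le> d"
  shows "has_bochner_integral M
    (\<lambda>\<omega>. (X \<omega> * (B b \<omega> $ i - B a \<omega> $ i)) * (Y \<omega> * (B d \<omega> $ i - B c \<omega> $ i)))
    (expectation (\<lambda>\<omega>. X \<omega> * Y \<omega>) * measure lborel ({a<..b} \<inter> {c<..d}))"
proof -
  have [measurable]: "X \<in> borel_measurable (F c)" "Y \<in> borel_measurable (F c)"
    using X Y measurable_F_mono[OF X(1) ac(3)] by auto
  have [measurable]: "X \<in> borel_measurable M" "Y \<in> borel_measurable M"
    using measurable_F_imp[OF X(1)] measurable_F_imp[OF Y(1)] by auto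
  have past: "has_bochner_integral M (\<lambda>\<omega>. (X \<omega> * (B e \<omega> $ i - B a \<omega> $ i) * Y \<omega>) * (B d \<omega> $ i - B c \<omega> $ i)) 0"
    if e: "a \<le> e" "e \<le> c" for e
  proof (rule adapted_mult_increment)
    have [measurable]: "(\<lambda>\<omega>. B e \<omega> $ i) \<in> borel_measurable M" "(\<lambda>\<omega>. B a \<omega> $ i) \<in> borel_measurable M"
      using e ac by auto
    have "(\<lambda>\<omega>. B e \<omega> $ i) \<in> borel_measurable (F c)" "(\<lambda>\<omega>. B a \<omega> $ i) \<in> borel_measurable (F c)"
      using e ac by (auto intro!: B_nth_measurable_F)
    then show "(\<lambda>\<omega>. X \<omega> * (B e \<omega> $ i - B a \<omega> $ i) * Y \<omega>) \<in> borel_measurable (F c)"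
      by measurable
    have "(\<lambda>\<omega>. (X \<omega>)\<^sup>2) \<in> borel_measurable (F a)" using X(1) by measurable
    \<comment> \<open>Applied to the square of \<open>X\<close>: the product of \<open>X\<close>
      with an increment is again square-integrable, hence so is its pairing with \<open>Y\<close>
      integrable.\<close>
    from adapted_mult_increment_square[OF this X(2) ac(1) e(1), of i]
    have "integrable M (\<lambda>\<omega>. (X \<omega> * (B e \<omega> $ i - B a \<omega> $ i))\<^sup>2)"
      by (simp add: has_bochner_integral_iff power_mult_distrib)
    then show "integrable M (\<lambda>\<omega>. X \<omega> * (B e \<omega> $ i - B a \<omega> $ i) * Y \<omega>)"
      by (intro integrable_mult_square_integrable Y) auto
  qed (use ac in auto)
  define Z where "Z = (\<lambda>\<omega>. X \<omega> * Y \<omega>)"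
  have Z: "Z \<in> borel_measurable (F c)" "integrable M Z"
    unfolding Z_def by (auto intro!: integrable_mult_square_integrable X Y)
  \<comment> \<open>Here \<open>e\<close> and \<open>f\<close> stand for the smaller and the larger
    of \<open>b\<close> and \<open>d\<close>; the integrand is \<open>Z\<close> times both
    increments from \<open>c\<close>, with the longer one split at \<open>e\<close>.\<close>
  have fut: "has_bochner_integral M (\<lambda>\<omega>. Z \<omega> * (B e \<omega> $ i - B c \<omega> $ i)\<^sup>2
       + (Z \<omega> * (B e \<omega> $ i - B c \<omega> $ i)) * (B f \<omega> $ i - B e \<omega> $ i)) (expectation Z * (e - c) + 0)"
    if e: "c \<le> e" "e \<le> f" for e f
  proof (rule has_bochner_integral_add)
    have c0: "0 \<le> c" using ac by simp
    show "has_bochner_integral M (\<lambda>\<omega>. Z \<omega> * (B e \<omega> $ i - B c \<omega> $ i)\<^sup>2) (expectation Z * (e - c))"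
      by (rule adapted_mult_increment_square[OF Z c0 e(1)])
    show "has_bochner_integral M (\<lambda>\<omega>. (Z \<omega> * (B e \<omega> $ i - B c \<omega> $ i)) * (B f \<omega> $ i - B e \<omega> $ i)) 0"
    proof (rule adapted_mult_increment)
      have "(\<lambda>\<omega>. B e \<omega> $ i) \<in> borel_measurable (F e)" "(\<lambda>\<omega>. B c \<omega> $ i) \<in> borel_measurable (F e)"
        using e ac by (auto intro!: B_nth_measurable_F)
      then show "(\<lambda>\<omega>. Z \<omega> * (B e \<omega> $ i - B c \<omega> $ i)) \<in> borel_measurable (F e)"
        using measurable_F_mono[OF Z(1) e(1)] by measurable
      show "integrable M (\<lambda>\<omega>. Z \<omega> * (B e \<omega> $ i - B c \<omega> $ i))"
        using adapted_mult_increment[OF Z c0 e(1)] by (simp add: has_bochner_integral_iff)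
    qed (use e ac in auto)
  qed
  consider "b \<le> c" | "c < b" "b \<le> d" | "c < b" "d < b" by linarith
  then show ?thesis
  proof cases
    case 1
    then have "{a<..b} \<inter> {c<..d} = {}" by auto
    then show ?thesis using past[of b] ac 1 by (simp add: mult_ac)
  next
    case 2
    then have *: "{a<..b} \<inter> {c<..d} = {c<..b}" using ac by auto
    from has_bochner_integral_add[OF past[of c] fut[of b d]] 2 ac
    show ?thesis by (simp add: * Z_def algebra_simps power2_eq_square)
  next
    case 3
    then have *: "{a<..b} \<inter> {c<..d} = {c<..d}" using ac by auto
    from has_bochner_integral_add[OF past[of c] fut[of d b]] 3 ac
    show ?thesis by (simp add: * Z_def algebra_simps power2_eq_square)
  qed
qed

lemma increment_product_expectation:
  assumes X: "X \<in> borel_measurable (F a)" "integrable M (\<lambda>\<omega>. (X \<omega>)\<^sup>2)"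
    and Y: "Y \<in> borel_measurable (F c)" "integrable M (\<lambda>\<omega>. (Y \<omega>)\<^sup>2)"
    and ac: "0 \<le> a" "a \<le> b" "0 \<le> c" "c \<le> d"
  shows "has_bochner_integral M
    (\<lambda>\<omega>. (X \<omega> * (B b \<omega> $ i - B a \<omega> $ i)) * (Y \<omega> * (B d \<omega> $ i - B c \<omega> $ i)))
    (expectation (\<lambda>\<omega>. X \<omega> * Y \<omega>) * measure lborel ({a<..b} \<inter> {c<..d}))"
proof (cases "a \<le> c")
  case False
  then show ?thesis
    using increment_product_expectation_ordered[OF Y X, of d b] ac by (simp add: mult_ac Int_commute)
qed (use increment_product_expectation_ordered[OF X Y] ac in auto)

text \<open>The intervals may overlap, so the difference of two sums over different partitions is covered
  without passing to a common refinement.\<close>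

lemma ito_isometry:
  assumes K: "finite K"
    and ab: "\<And>k. k \<in> K \<Longrightarrow> 0 \<le> a k" "\<And>k. k \<in> K \<Longrightarrow> a k \<le> b k" "\<And>k. k \<in> K \<Longrightarrow> b k \<le> T"
    and X: "\<And>k. k \<in> K \<Longrightarrow> X k \<in> borel_measurable (F (a k))" "\<And>k. k \<in> K \<Longrightarrow> integrable M (\<lambda>\<omega>. (X k \<omega>)\<^sup>2)"
  shows "(\<integral>\<^sup>+\<omega>. ennreal ((\<Sum>k\<in>K. X k \<omega> * (B (b k) \<omega> $ i - B (a k) \<omega> $ i))\<^sup>2) \<partial>M) =
    (\<integral>\<^sup>+(\<omega>, t). ennreal ((\<Sum>k\<in>K. X k \<omega> * indicator {a k<..b k} t)\<^sup>2)
      \<partial>(M \<Otimes>\<^sub>M restrict_space lborel {0..T}))"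
proof -
  let ?L = "restrict_space lborel {0..T} :: real measure"
  \<comment> \<open>Both sides expand to this double sum: on the left by the formula for pairs of
    increments, on the right because Fubini integrates a product of two indicators to the length of
    the overlap.\<close>
  define v where "v = (\<Sum>k\<in>K. \<Sum>l\<in>K. expectation (\<lambda>\<omega>. X k \<omega> * X l \<omega>) * measure lborel ({a k<..b k} \<inter> {a l<..b l}))"
  have [measurable]: "k \<in> K \<Longrightarrow> X k \<in> borel_measurable M" for k
    using measurable_F_imp[OF X(1)] by auto
  have finL: "finite_measure ?L"
    by standard (simp add: emeasure_restrict_space space_restrict_space emeasure_lborel_Icc_eq)
  have "has_bochner_integral M (\<lambda>\<omega>. \<Sum>k\<in>K. \<Sum>l\<in>K. (X k \<omega> * (B (b k) \<omega> $ i - B (a k) \<omega> $ i)) * (X l \<omega> * (B (b l) \<omega> $ i - B (a l) \<omega> $ i))) v"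
    unfolding v_def by (intro has_bochner_integral_sum increment_product_expectation X ab)
  then have 1: "has_bochner_integral M (\<lambda>\<omega>. (\<Sum>k\<in>K. X k \<omega> * (B (b k) \<omega> $ i - B (a k) \<omega> $ i))\<^sup>2) v"
    by (simp add: power2_eq_square sum_product)
  have "has_bochner_integral (M \<Otimes>\<^sub>M ?L) (\<lambda>z. \<Sum>k\<in>K. \<Sum>l\<in>K. (\<lambda>(\<omega>, t). (X k \<omega> * X l \<omega>) * (indicator ({a k<..b k} \<inter> {a l<..b l}) t :: real)) z) v"
    unfolding v_def
  proof (intro has_bochner_integral_sum)
    fix k l assume kl: "k \<in> K" "l \<in> K"
    define I where "I = {a k<..b k} \<inter> {a l<..b l}"
    have "I \<subseteq> {0..T}" "I \<in> sets borel"
      using ab(1)[OF kl(1)] ab(3)[OF kl(1)] by (auto simp: I_def)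
    then have "measure ?L I = measure lborel I" "I \<in> sets ?L" "I \<inter> {0..T} = I"
      by (auto simp: measure_restrict_space sets_restrict_space_iff)
    then show "has_bochner_integral (M \<Otimes>\<^sub>M ?L) (\<lambda>(\<omega>, t). (X k \<omega> * X l \<omega>) * (indicator ({a k<..b k} \<inter> {a l<..b l}) t :: real))
       (expectation (\<lambda>\<omega>. X k \<omega> * X l \<omega>) * measure lborel ({a k<..b k} \<inter> {a l<..b l}))"
      using has_bochner_integral_pair_mult[OF sigma_finite_measure_axioms finite_measure.axioms(1)[OF finL],
          of "\<lambda>\<omega>. X k \<omega> * X l \<omega>" "indicator I"]
        integrable_mult_square_integrable[of "X k" M "X l"] X kl finite_measure.emeasure_finite[OF finL]
      unfolding I_def[symmetric]
      by (simp add: less_top space_restrict_space)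
  qed
  then have 2: "has_bochner_integral (M \<Otimes>\<^sub>M ?L) (\<lambda>(\<omega>, t). (\<Sum>k\<in>K. X k \<omega> * indicator {a k<..b k} t)\<^sup>2) v"
    by (rule back_subst[where P = "\<lambda>f. has_bochner_integral _ f v"])
       (auto simp: fun_eq_iff power2_eq_square sum_product indicator_def intro!: sum.cong)
  show ?thesis
    using nn_integral_eq_integral[of M "\<lambda>\<omega>. (\<Sum>k\<in>K. X k \<omega> * (B (b k) \<omega> $ i - B (a k) \<omega> $ i))\<^sup>2"]
      nn_integral_eq_integral[of "M \<Otimes>\<^sub>M ?L" "\<lambda>(\<omega>, t). (\<Sum>k\<in>K. X k \<omega> * indicator {a k<..b k} t)\<^sup>2"] 1 2
    by (simp add: has_bochner_integral_iff split_beta')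
qed

end

subsection \<open>Riemann sums\<close>

lemma ennreal_square_diff_le:
  "ennreal ((x - z)\<^sup>2) \<le> 2 * ennreal ((x - y)\<^sup>2) + 2 * ennreal ((y - z)\<^sup>2)"
proof -
  have "(x - z)\<^sup>2 \<le> 2 * (x - y)\<^sup>2 + 2 * (y - z)\<^sup>2"
    using zero_le_power2[of "(x - y) - (y - z)"] by (simp add: power2_eq_square algebra_simps)
  then have "ennreal ((x - z)\<^sup>2) \<le> ennreal (2 * (x - y)\<^sup>2 + 2 * (y - z)\<^sup>2)"
    by (rule ennreal_leI)
  also have "\<dots> = 2 * ennreal ((x - y)\<^sup>2) + 2 * ennreal ((y - z)\<^sup>2)"
    by (simp add: ennreal_mult)
  finally show ?thesis .
qed

text \<open>The triangle inequality for squared L2 distances, at the price of a factor 2.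
  Nonnegative integrals avoid integrability conditions.\<close>

lemma nn_integral_square_diff_le:
  assumes [measurable]: "f \<in> borel_measurable M" "g \<in> borel_measurable M" "h \<in> borel_measurable M"
  shows "(\<integral>\<^sup>+x. ennreal ((f x - h x)\<^sup>2) \<partial>M) \<le>
    2 * (\<integral>\<^sup>+x. ennreal ((f x - g x)\<^sup>2) \<partial>M) + 2 * (\<integral>\<^sup>+x. ennreal ((g x - h x)\<^sup>2) \<partial>M)"
proof -
  have "(\<integral>\<^sup>+x. ennreal ((f x - h x)\<^sup>2) \<partial>M) \<le> (\<integral>\<^sup>+x. 2 * ennreal ((f x - g x)\<^sup>2) + 2 * ennreal ((g x - h x)\<^sup>2) \<partial>M)"
    by (intro nn_integral_mono ennreal_square_diff_le)
  also have "\<dots> = 2 * (\<integral>\<^sup>+x. ennreal ((f x - g x)\<^sup>2) \<partial>M) + 2 * (\<integral>\<^sup>+x. ennreal ((g x - h x)\<^sup>2) \<partial>M)"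
    by (simp add: nn_integral_add nn_integral_cmult)
  finally show ?thesis .
qed

lemma simple_integrand_partition:
  assumes "simple_integrand F T m \<tau> \<xi>" "k \<le> m"
  shows "0 \<le> \<tau> k" "\<tau> k \<le> T"
proof -
  have \<tau>: "\<tau> 0 = 0" "\<tau> m = T" "\<And>k. k < m \<Longrightarrow> \<tau> k \<le> \<tau> (Suc k)"
    using assms by (auto simp: simple_integrand_def)
  show "0 \<le> \<tau> k" using assms(2)
    by (induction k) (use \<tau> in \<open>auto intro: order_trans\<close>)
  show "\<tau> k \<le> T" using assms(2)
    by (induction k rule: inc_induct) (use \<tau> in \<open>auto intro: order_trans\<close>)
qed

context brownian_plane
begin

text \<open>\<open>i\<close> is the integrator and \<open>j\<close> the integrand. Evaluation at
  left endpoints keeps the coefficients adapted; they are unbounded, so the sum is not an instance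
  of a simple integral.\<close>

definition riemann_sum :: "2 \<Rightarrow> 2 \<Rightarrow> real \<Rightarrow> nat \<Rightarrow> 'a \<Rightarrow> real" where
  "riemann_sum i j h n \<omega> = (\<Sum>k<n. B (real k * h) \<omega> $ j * (B (real (Suc k) * h) \<omega> $ i - B (real k * h) \<omega> $ i))"

definition step_process :: "2 \<Rightarrow> real \<Rightarrow> nat \<Rightarrow> real \<Rightarrow> 'a \<Rightarrow> real" where
  "step_process j h n t \<omega> = (\<Sum>k<n. B (real k * h) \<omega> $ j * indicator {real k * h<..real (Suc k) * h} t)"

lemma step_process_eq:
  assumes "h > 0" "k < n" "real k * h < t" "t \<le> real (Suc k) * h"
  shows "step_process j h n t \<omega> = B (real k * h) \<omega> $ j"
proof -
  have uniq: "l = k" if "real l * h < t" "t \<le> real (Suc l) * h" for l :: nat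
  proof -
    have "real l * h < real (Suc k) * h" "real k * h < real (Suc l) * h" using assms that by linarith+
    then have "real l < real (Suc k)" "real k < real (Suc l)"
      using \<open>h > 0\<close> by (auto simp: mult_less_cancel_right)
    then show ?thesis by linarith
  qed
  have "B (real l * h) \<omega> $ j * indicator {real l * h<..real (Suc l) * h} t = (if l = k then B (real k * h) \<omega> $ j else 0)" for l :: nat
    using uniq[of l] assms by (cases "l = k") (auto simp: indicator_def)
  then show ?thesis using \<open>k < n\<close> by (simp add: step_process_def)
qed

lemma step_process_error:
  assumes "h > 0" "0 < t" "t \<le> real n * h"
  shows "(\<integral>\<^sup>+\<omega>. ennreal ((step_process j h n t \<omega> - B t \<omega> $ j)\<^sup>2) \<partial>M) \<le> ennreal h"
proof -
  \<comment> \<open>The index of the interval containing \<open>t\<close>; intervals are open on the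
    left and closed on the right, hence a ceiling minus one.\<close>
  define k where "k = nat (\<lceil>t / h\<rceil> - 1)"
  have "t / h > 0" "t / h \<le> n" using assms by (auto simp: field_simps)
  then have "\<lceil>t / h\<rceil> \<ge> 1" "\<lceil>t / h\<rceil> \<le> n" by (auto simp: ceiling_le_iff)
  then have k: "k < n" "real k = real_of_int \<lceil>t / h\<rceil> - 1" unfolding k_def by linarith+
  then have "real k < t / h" "t / h \<le> Suc k" by linarith+
  then have kt: "real k * h < t" "t \<le> real (Suc k) * h" using \<open>h > 0\<close> by (auto simp: field_simps)
  have "has_bochner_integral M (\<lambda>\<omega>. (B t \<omega> $ j - B (real k * h) \<omega> $ j)\<^sup>2) (t - real k * h)"
    using kt \<open>h > 0\<close> by (intro increment_square_integrable) auto
  then have "(\<integral>\<^sup>+\<omega>. ennreal ((B t \<omega> $ j - B (real k * h) \<omega> $ j)\<^sup>2) \<partial>M) = ennreal (t - real k * h)"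
    by (subst nn_integral_eq_integral) (auto simp: has_bochner_integral_iff)
  also have "\<dots> \<le> ennreal h" using kt by (intro ennreal_leI) (simp add: algebra_simps)
  finally show ?thesis
    unfolding step_process_eq[OF \<open>h > 0\<close> k(1) kt] power2_commute[of "B (real k * h) _ $ j"] .
qed

lemma step_process_measurable:
  assumes "h \<ge> 0"
  shows "(\<lambda>(\<omega>, t). step_process j h n t \<omega>) \<in> borel_measurable (M \<Otimes>\<^sub>M restrict_space lborel A)"
proof -
  have [measurable]: "(\<lambda>\<omega>. B (real k * h) \<omega> $ j) \<in> borel_measurable M" for k
    using assms by simp
  have [measurable]: "(\<lambda>t. indicator {a<..b} t :: real) \<in> borel_measurable (restrict_space lborel A)" for a b
    by (rule measurable_restrict_space1) simp
  show ?thesis unfolding step_process_def by measurable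
qed

text \<open>The pointwise error bound is to be integrated over time, but the integrand is measurable
  only for the completed product. It is replaced by a Borel version \<open>H'\<close>, to which
  Fubini applies, and for almost every \<open>t\<close> the section of \<open>H'\<close> is almost
  surely \<open>B t\<close>.\<close>

lemma step_process_error_completion:
  assumes "h > 0" "real n * h = T"
    and H: "(\<lambda>(\<omega>, t). B t \<omega> $ j) \<in> borel_measurable (completion (M \<Otimes>\<^sub>M restrict_space lborel {0..T}))"
  shows "(\<integral>\<^sup>+z. ennreal (((case z of (\<omega>, t) \<Rightarrow> step_process j h n t \<omega>) - (case z of (\<omega>, t) \<Rightarrow> B t \<omega> $ j))\<^sup>2)
    \<partial>completion (M \<Otimes>\<^sub>M restrict_space lborel {0..T})) \<le> ennreal (T * h)"
proof -
  let ?L = "restrict_space lborel {0..T} :: real measure"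
  have "T \<ge> 0" using assms(1,2) by auto
  interpret L: finite_measure "?L"
    by standard (simp add: emeasure_restrict_space space_restrict_space emeasure_lborel_Icc_eq)
  interpret PS: pair_sigma_finite M "?L" ..
  have [measurable]: "(\<lambda>(\<omega>, t). step_process j h n t \<omega>) \<in> borel_measurable (M \<Otimes>\<^sub>M ?L)"
    using \<open>h > 0\<close> by (intro step_process_measurable) simp
  obtain H' where H' [measurable]: "H' \<in> borel_measurable (M \<Otimes>\<^sub>M ?L)"
    and eq: "AE z in M \<Otimes>\<^sub>M ?L. (case z of (\<omega>, t) \<Rightarrow> B t \<omega> $ j) = H' z"
    using completion_ex_borel_measurable_real[OF H] by blast
  obtain Z where Z: "{z \<in> space (M \<Otimes>\<^sub>M ?L). (case z of (\<omega>, t) \<Rightarrow> B t \<omega> $ j) \<noteq> H' z} \<subseteq> Z" "Z \<in> null_sets (M \<Otimes>\<^sub>M ?L)"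
    using eq unfolding eventually_ae_filter by auto
  have eq_outside: "B t \<omega> $ j = H' (\<omega>, t)" if "\<omega> \<in> space M" "t \<in> space ?L" "(\<omega>, t) \<notin> Z" for \<omega> t
    using subsetD[OF Z(1), of "(\<omega>, t)"] that by (auto simp: space_pair_measure)
  have "AE z in M \<Otimes>\<^sub>M ?L. z \<notin> Z" by (rule AE_not_in[OF Z(2)])
  from PS.AE_pair[OF this] have "AE \<omega> in M. AE t in ?L. (\<omega>, t) \<notin> Z" .
  moreover have "{z \<in> space (M \<Otimes>\<^sub>M ?L). (fst z, snd z) \<notin> Z} \<in> sets (M \<Otimes>\<^sub>M ?L)"
    using sets.compl_sets[OF null_setsD2[OF Z(2)]] by (simp add: set_diff_eq)
  \<comment> \<open>The order of the two quantifiers may be exchanged because the exceptional set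
    \<open>Z\<close> is a measurable null set.\<close>
  ultimately have swap: "AE t in ?L. AE \<omega> in M. (\<omega>, t) \<notin> Z"
    using PS.AE_commute[of "\<lambda>\<omega> t. (\<omega>, t) \<notin> Z"] by blast
  \<comment> \<open>Time 0 lies in no interval of the step process and is discarded.\<close>
  have pos: "AE t in ?L. t > 0"
    using AE_lborel_singleton[of "0::real"] by (subst AE_restrict_space_iff) (auto elim: eventually_mono)
  have "(\<integral>\<^sup>+z. ennreal (((case z of (\<omega>, t) \<Rightarrow> step_process j h n t \<omega>) - (case z of (\<omega>, t) \<Rightarrow> B t \<omega> $ j))\<^sup>2) \<partial>completion (M \<Otimes>\<^sub>M ?L)) =
    (\<integral>\<^sup>+z. ennreal (((case z of (\<omega>, t) \<Rightarrow> step_process j h n t \<omega>) - H' z)\<^sup>2) \<partial>(M \<Otimes>\<^sub>M ?L))"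
    unfolding nn_integral_completion using eq by (intro nn_integral_cong_AE) (auto elim: eventually_mono)
  also have "\<dots> = (\<integral>\<^sup>+t. \<integral>\<^sup>+\<omega>. ennreal ((step_process j h n t \<omega> - H' (\<omega>, t))\<^sup>2) \<partial>M \<partial>?L)"
    by (subst PS.nn_integral_snd [symmetric]) auto
  also have "\<dots> \<le> (\<integral>\<^sup>+t. ennreal h \<partial>?L)"
  proof (rule nn_integral_mono_AE, use swap pos AE_space in eventually_elim)
    fix t assume *: "AE \<omega> in M. (\<omega>, t) \<notin> Z" "t > 0" "t \<in> space ?L"
    have "(\<integral>\<^sup>+\<omega>. ennreal ((step_process j h n t \<omega> - H' (\<omega>, t))\<^sup>2) \<partial>M) = (\<integral>\<^sup>+\<omega>. ennreal ((step_process j h n t \<omega> - B t \<omega> $ j)\<^sup>2) \<partial>M)"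
      by (intro nn_integral_cong_AE, use *(1) AE_space[of M] in eventually_elim)
         (use *(3) eq_outside in auto)
    also have "\<dots> \<le> ennreal h"
      using * assms by (intro step_process_error) (auto simp: space_restrict_space)
    finally show "(\<integral>\<^sup>+\<omega>. ennreal ((step_process j h n t \<omega> - H' (\<omega>, t))\<^sup>2) \<partial>M) \<le> ennreal h" .
  qed
  also have "\<dots> = ennreal (T * h)"
    using \<open>T \<ge> 0\<close> \<open>h > 0\<close>
    by (simp add: emeasure_restrict_space space_restrict_space ennreal_mult' [symmetric] mult.commute)
  finally show ?thesis .
qed

text \<open>Both sums are merged into a single one over the disjoint union \<open>K\<close> of the
  index sets, with the simple coefficients negated; the isometry then applies to the difference
  directly.\<close>

lemma riemann_sum_isometry:
  assumes "h > 0" "real n * h = T" and simple: "simple_integrand F T m \<tau> \<xi>"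
  shows "(\<integral>\<^sup>+\<omega>. ennreal ((riemann_sum i j h n \<omega> - simple_ito_integral (\<lambda>t \<omega>. B t \<omega> $ i) m \<tau> \<xi> \<omega>)\<^sup>2) \<partial>M) =
    (\<integral>\<^sup>+(\<omega>, t). ennreal ((step_process j h n t \<omega> - simple_process m \<tau> \<xi> t \<omega>)\<^sup>2)
      \<partial>(M \<Otimes>\<^sub>M restrict_space lborel {0..T}))"
proof -
  define a where "a = case_sum (\<lambda>k. real k * h) \<tau>"
  define b where "b = case_sum (\<lambda>k. real (Suc k) * h) (\<lambda>k. \<tau> (Suc k))"
  define X where "X = case_sum (\<lambda>k \<omega>. B (real k * h) \<omega> $ j) (\<lambda>k \<omega>. - \<xi> k \<omega>)"
  define K where "K = {..<n} <+> {..<m}"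
  have K: "finite K" by (simp add: K_def)
  have sum_K: "(\<Sum>k\<in>K. f k) = (\<Sum>k<n. f (Inl k)) + (\<Sum>k<m. f (Inr k))" for f :: "nat + nat \<Rightarrow> real"
    unfolding K_def by (subst sum.Plus) auto
  have \<tau>: "k < m \<Longrightarrow> 0 \<le> \<tau> k" "k < m \<Longrightarrow> \<tau> k \<le> \<tau> (Suc k)" "k < m \<Longrightarrow> \<tau> (Suc k) \<le> T" for k
    using simple_integrand_partition[OF simple, of k] simple_integrand_partition[OF simple, of "Suc k"] simple
    by (auto simp: simple_integrand_def)
  have \<xi>: "\<xi> k \<in> borel_measurable (F (\<tau> k))" "integrable M (\<lambda>\<omega>. (\<xi> k \<omega>)\<^sup>2)" if "k < m" for k
  proof -
    have m: "\<xi> k \<in> borel_measurable (F (\<tau> k))" and "\<exists>C. \<forall>\<omega>\<in>space M. \<bar>\<xi> k \<omega>\<bar> \<le> C"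
      using simple that unfolding simple_integrand_def space_F by simp_all
    then obtain C where C: "\<And>\<omega>. \<omega> \<in> space M \<Longrightarrow> \<bar>\<xi> k \<omega>\<bar> \<le> C" by blast
    show "\<xi> k \<in> borel_measurable (F (\<tau> k))" by fact
    have "\<xi> k \<in> borel_measurable M" using m by (rule measurable_F_imp)
    then show "integrable M (\<lambda>\<omega>. (\<xi> k \<omega>)\<^sup>2)"
      by (intro integrable_const_bound[where B = "C\<^sup>2"])
         (use power_mono[OF C, of _ 2] in auto)
  qed
  \<comment> \<open>The variance formula concerns increments; \<open>B 0\<close> vanishes only
    almost surely.\<close>
  have Bsq: "integrable M (\<lambda>\<omega>. (B s \<omega> $ j)\<^sup>2)" if "0 \<le> s" for s
  proof -
    have "integrable M (\<lambda>\<omega>. (B s \<omega> $ j - B 0 \<omega> $ j)\<^sup>2)"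
      using increment_square_integrable[of 0 s j] that by (auto simp: has_bochner_integral_iff)
    moreover have "AE \<omega> in M. (B s \<omega> $ j - B 0 \<omega> $ j)\<^sup>2 = (B s \<omega> $ j)\<^sup>2"
      using AE_B_0 by eventually_elim simp
    ultimately show ?thesis
      using that by (subst (asm) integrable_cong_AE) auto
  qed
  have "(\<integral>\<^sup>+\<omega>. ennreal ((\<Sum>k\<in>K. X k \<omega> * (B (b k) \<omega> $ i - B (a k) \<omega> $ i))\<^sup>2) \<partial>M) =
    (\<integral>\<^sup>+(\<omega>, t). ennreal ((\<Sum>k\<in>K. X k \<omega> * indicator {a k<..b k} t)\<^sup>2)
      \<partial>(M \<Otimes>\<^sub>M restrict_space lborel {0..T}))"
  proof (rule ito_isometry[OF K])
    fix k assume "k \<in> K"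
    show "0 \<le> a k" using \<open>k \<in> K\<close> \<tau> \<open>h > 0\<close> by (auto simp: K_def a_def)
    show "a k \<le> b k" using \<open>k \<in> K\<close> \<tau> \<open>h > 0\<close> by (auto simp: K_def a_def b_def)
    show "b k \<le> T"
    proof (cases k)
      case (Inl l)
      then have "Suc l \<le> n" using \<open>k \<in> K\<close> by (auto simp: K_def)
      then have "real (Suc l) * h \<le> real n * h" using \<open>h > 0\<close> by (intro mult_right_mono) auto
      then show ?thesis using Inl assms by (simp add: b_def)
    qed (use \<open>k \<in> K\<close> \<tau> in \<open>auto simp: K_def b_def\<close>)
    show "X k \<in> borel_measurable (F (a k))"
      using \<open>k \<in> K\<close> \<xi> \<open>h > 0\<close> by (auto simp: K_def X_def a_def intro!: B_nth_measurable_F borel_measurable_uminus)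
    show "integrable M (\<lambda>\<omega>. (X k \<omega>)\<^sup>2)"
      using \<open>k \<in> K\<close> \<xi> \<open>h > 0\<close> by (auto simp: K_def X_def intro!: Bsq)
  qed
  then show ?thesis
    by (simp only: sum_K) (simp add: a_def b_def X_def riemann_sum_def step_process_def simple_ito_integral_def
        simple_process_def sum_negf)
qed

text \<open>The Riemann sum is compared with \<open>I\<close> through the simple integrals defining
  \<open>I\<close>. The isometry moves the first distance to the integrands, where the Brownian path
  is inserted. As the approximations converge, only \<open>T * h\<close> survives; the factor 4
  comes from using the squared triangle inequality twice.\<close>

lemma riemann_sum_error:
  assumes "h > 0" "real n * h = T"
    and ito: "has_ito_integral M F (\<lambda>t \<omega>. B t \<omega> $ i) T (\<lambda>t \<omega>. B t \<omega> $ j) I"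
  shows "(\<integral>\<^sup>+\<omega>. ennreal ((riemann_sum i j h n \<omega> - I \<omega>)\<^sup>2) \<partial>M) \<le> 4 * ennreal (T * h)"
proof -
  let ?P = "M \<Otimes>\<^sub>M restrict_space lborel {0..T}"
  let ?W = "\<lambda>t \<omega>. B t \<omega> $ i"
  obtain m \<tau> \<xi> where simple: "\<And>l. simple_integrand F T (m l) (\<tau> l) (\<xi> l)"
    and lim1: "(\<lambda>l. \<integral>\<^sup>+(\<omega>, t). ennreal ((simple_process (m l) (\<tau> l) (\<xi> l) t \<omega> - B t \<omega> $ j)\<^sup>2) \<partial>completion ?P) \<longlonglongrightarrow> 0"
    and lim2: "(\<lambda>l. \<integral>\<^sup>+\<omega>. ennreal ((simple_ito_integral ?W (m l) (\<tau> l) (\<xi> l) \<omega> - I \<omega>)\<^sup>2) \<partial>M) \<longlonglongrightarrow> 0"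
    and I [measurable]: "I \<in> borel_measurable M"
    and H [measurable]: "(\<lambda>(\<omega>, t). B t \<omega> $ j) \<in> borel_measurable (completion ?P)"
    using ito unfolding has_ito_integral_def by blast
  define e1 where "e1 l = (\<integral>\<^sup>+(\<omega>, t). ennreal ((simple_process (m l) (\<tau> l) (\<xi> l) t \<omega> - B t \<omega> $ j)\<^sup>2) \<partial>completion ?P)" for l
  define e2 where "e2 l = (\<integral>\<^sup>+\<omega>. ennreal ((simple_ito_integral ?W (m l) (\<tau> l) (\<xi> l) \<omega> - I \<omega>)\<^sup>2) \<partial>M)" for l
  have [measurable]: "(\<lambda>(\<omega>, t). step_process j h n t \<omega>) \<in> borel_measurable ?P"
    using \<open>h > 0\<close> by (intro step_process_measurable) simp
  have [measurable]: "(\<lambda>\<omega>. B (real k * h) \<omega> $ q) \<in> borel_measurable M" "(\<lambda>\<omega>. B ((1 + real k) * h) \<omega> $ q) \<in> borel_measurable M" for k q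
    using \<open>h > 0\<close> by auto
  have [measurable]: "riemann_sum i j h n \<in> borel_measurable M"
    unfolding riemann_sum_def by simp
  have bound: "(\<integral>\<^sup>+\<omega>. ennreal ((riemann_sum i j h n \<omega> - I \<omega>)\<^sup>2) \<partial>M) \<le> 2 * (2 * ennreal (T * h) + 2 * e1 l) + 2 * e2 l" for l
  proof -
    have [measurable]: "\<xi> l k \<in> borel_measurable M" if "k < m l" for k
      using simple[of l] that by (auto simp: simple_integrand_def intro: measurable_F_imp)
    have [measurable]: "(\<lambda>\<omega>. B (\<tau> l k) \<omega> $ i) \<in> borel_measurable M" if "k \<le> m l" for k
      using simple_integrand_partition[OF simple that] by simp
    have ind [measurable]: "(\<lambda>t. indicator {a<..b} t :: real) \<in> borel_measurable (restrict_space lborel {0..T})" for a b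
      by (rule measurable_restrict_space1) simp
    have sp [measurable]: "(\<lambda>(\<omega>, t). simple_process (m l) (\<tau> l) (\<xi> l) t \<omega>) \<in> borel_measurable ?P"
      unfolding simple_process_def by measurable
    have [measurable]: "simple_ito_integral ?W (m l) (\<tau> l) (\<xi> l) \<in> borel_measurable M"
      unfolding simple_ito_integral_def by measurable
    have "(\<integral>\<^sup>+\<omega>. ennreal ((riemann_sum i j h n \<omega> - simple_ito_integral ?W (m l) (\<tau> l) (\<xi> l) \<omega>)\<^sup>2) \<partial>M) =
      (\<integral>\<^sup>+z. ennreal (((case z of (\<omega>, t) \<Rightarrow> step_process j h n t \<omega>) - (case z of (\<omega>, t) \<Rightarrow> simple_process (m l) (\<tau> l) (\<xi> l) t \<omega>))\<^sup>2) \<partial>completion ?P)"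
      unfolding riemann_sum_isometry[OF assms(1,2) simple] nn_integral_completion by (simp add: split_beta')
    also have "\<dots> \<le> 2 * (\<integral>\<^sup>+z. ennreal (((case z of (\<omega>, t) \<Rightarrow> step_process j h n t \<omega>) - (case z of (\<omega>, t) \<Rightarrow> B t \<omega> $ j))\<^sup>2) \<partial>completion ?P)
      + 2 * (\<integral>\<^sup>+z. ennreal (((case z of (\<omega>, t) \<Rightarrow> B t \<omega> $ j) - (case z of (\<omega>, t) \<Rightarrow> simple_process (m l) (\<tau> l) (\<xi> l) t \<omega>))\<^sup>2) \<partial>completion ?P)"
      by (intro nn_integral_square_diff_le measurable_completion[of _ ?P] H) auto
    also have "\<dots> \<le> 2 * ennreal (T * h) + 2 * e1 l"
      using step_process_error_completion[OF assms(1,2) H]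
      by (intro add_mono mult_left_mono) (auto simp: e1_def split_beta' power2_commute[of "B _ _ $ j"])
    finally have "2 * (\<integral>\<^sup>+\<omega>. ennreal ((riemann_sum i j h n \<omega> - simple_ito_integral ?W (m l) (\<tau> l) (\<xi> l) \<omega>)\<^sup>2) \<partial>M) + 2 * e2 l
      \<le> 2 * (2 * ennreal (T * h) + 2 * e1 l) + 2 * e2 l"
      by (intro add_mono mult_left_mono) auto
    then show ?thesis
      by (rule order_trans[rotated]) (unfold e2_def, intro nn_integral_square_diff_le, auto)
  qed
  have "(\<lambda>l. 2 * (2 * ennreal (T * h) + 2 * e1 l) + 2 * e2 l) \<longlonglongrightarrow> 2 * (2 * ennreal (T * h) + 2 * 0) + 2 * 0"
    using lim1 lim2 unfolding e1_def[symmetric] e2_def[symmetric]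
    by (intro tendsto_add ennreal_tendsto_cmult tendsto_const) auto
  from LIMSEQ_le_const[OF this] bound
  have "(\<integral>\<^sup>+\<omega>. ennreal ((riemann_sum i j h n \<omega> - I \<omega>)\<^sup>2) \<partial>M) \<le> 2 * (2 * ennreal (T * h) + 2 * 0) + 2 * 0"
    by blast
  then show ?thesis by simp
qed

end

subsection \<open>Characteristic function of the area\<close>

context brownian_plane
begin

text \<open>Freezing: since \<open>X\<close> is known at time \<open>s\<close>, its joint law with
  the increment is a product, and the increment can be integrated out with \<open>X\<close> held
  fixed. The bound on \<open>g\<close> justifies Fubini.\<close>

lemma expectation_indep_increment:
  fixes g :: "'c \<times> (real \<times> real) \<Rightarrow> complex"
  assumes X: "X \<in> measurable (F s) L" and st: "0 \<le> s" "s < t"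
    and g [measurable]: "g \<in> borel_measurable (L \<Otimes>\<^sub>M (borel \<Otimes>\<^sub>M borel))" and bounded: "\<And>z. norm (g z) \<le> 1"
  defines "N \<equiv> density lborel (normal_density 0 (sqrt (t - s)))"
  shows "expectation (\<lambda>\<omega>. g (X \<omega>, (B t \<omega> $ 1 - B s \<omega> $ 1, B t \<omega> $ 2 - B s \<omega> $ 2))) =
    expectation (\<lambda>\<omega>. CLINT y|N \<Otimes>\<^sub>M N. g (X \<omega>, y))"
proof -
  define Y where "Y = (\<lambda>\<omega>. (B t \<omega> $ 1 - B s \<omega> $ 1, B t \<omega> $ 2 - B s \<omega> $ 2))"
  have [measurable]: "X \<in> measurable M L" using X by (rule measurable_F_imp)
  have [measurable]: "(\<lambda>\<omega>. B s \<omega> $ j) \<in> borel_measurable M" "(\<lambda>\<omega>. B t \<omega> $ j) \<in> borel_measurable M"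
    "B s \<in> borel_measurable M" "B t \<in> borel_measurable M" for j
    using st by auto
  have [measurable]: "Y \<in> measurable M (borel \<Otimes>\<^sub>M borel)" unfolding Y_def by measurable
  have Y: "distr M (borel \<Otimes>\<^sub>M borel) Y = N \<Otimes>\<^sub>M N"
    unfolding Y_def N_def by (rule distr_increment_pair[OF st])
  interpret X: prob_space "distr M L X" by (rule prob_space_distr) simp
  interpret Y: prob_space "distr M (borel \<Otimes>\<^sub>M borel) Y" by (rule prob_space_distr) simp
  interpret XY: pair_prob_space "distr M L X" "distr M (borel \<Otimes>\<^sub>M borel) Y" ..
  have joint: "distr M L X \<Otimes>\<^sub>M distr M (borel \<Otimes>\<^sub>M borel) Y = distr M (L \<Otimes>\<^sub>M (borel \<Otimes>\<^sub>M borel)) (\<lambda>\<omega>. (X \<omega>, Y \<omega>))"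
  proof (rule pair_measure_eqI)
    show "sigma_finite_measure (distr M L X)" "sigma_finite_measure (distr M (borel \<Otimes>\<^sub>M borel) Y)"
      by unfold_locales
    show "sets (distr M L X \<Otimes>\<^sub>M distr M (borel \<Otimes>\<^sub>M borel) Y) = sets (distr M (L \<Otimes>\<^sub>M (borel \<Otimes>\<^sub>M borel)) (\<lambda>\<omega>. (X \<omega>, Y \<omega>)))"
      by (simp cong: sets_pair_measure_cong)
    fix A C assume "A \<in> sets (distr M L X)" "C \<in> sets (distr M (borel \<Otimes>\<^sub>M borel) Y)"
    then have AC [measurable]: "A \<in> sets L" "C \<in> sets (borel \<Otimes>\<^sub>M borel)" by auto
    \<comment> \<open>Independence is given for preimages under the vector increment, so events of
      the pair \<open>Y\<close> are brought into that form.\<close>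
    have "Y -` C \<inter> space M = (\<lambda>\<omega>. B t \<omega> - B s \<omega>) -` {x. (x $ 1, x $ 2) \<in> C} \<inter> space M"
      by (auto simp: Y_def)
    moreover have "{x::real^2. (x $ 1, x $ 2) \<in> C} \<in> sets borel"
      by measurable
    ultimately have "Y -` C \<inter> space M \<in> {(\<lambda>\<omega>. B t \<omega> - B s \<omega>) -` A \<inter> space M | A. A \<in> sets borel}"
      by blast
    then have "prob ((X -` A \<inter> space M) \<inter> (Y -` C \<inter> space M)) = prob (X -` A \<inter> space M) * prob (Y -` C \<inter> space M)"
      using measurable_sets[OF X AC(1)] by (intro indep_setD[OF indep_set_increment[OF st]]) simp_all
    moreover have "(\<lambda>\<omega>. (X \<omega>, Y \<omega>)) -` (A \<times> C) \<inter> space M = (X -` A \<inter> space M) \<inter> (Y -` C \<inter> space M)"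
      by auto
    ultimately show "emeasure (distr M L X) A * emeasure (distr M (borel \<Otimes>\<^sub>M borel) Y) C =
      emeasure (distr M (L \<Otimes>\<^sub>M (borel \<Otimes>\<^sub>M borel)) (\<lambda>\<omega>. (X \<omega>, Y \<omega>))) (A \<times> C)"
      by (simp add: emeasure_distr emeasure_eq_measure ennreal_mult'')
  qed
  have "expectation (\<lambda>\<omega>. g (X \<omega>, Y \<omega>)) = (CLINT z|distr M L X \<Otimes>\<^sub>M distr M (borel \<Otimes>\<^sub>M borel) Y. g z)"
    unfolding joint by (subst integral_distr) auto
  also have "\<dots> = (CLINT x|distr M L X. CLINT y|distr M (borel \<Otimes>\<^sub>M borel) Y. g (x, y))"
    using bounded by (intro XY.integral_fst' [symmetric] XY.P.integrable_const_bound[where B = 1]) auto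
  also have "\<dots> = expectation (\<lambda>\<omega>. CLINT y|distr M (borel \<Otimes>\<^sub>M borel) Y. g (X \<omega>, y))"
    by (subst integral_distr) auto
  finally show ?thesis unfolding Y unfolding Y_def .
qed

text \<open>The mixed terms of the two Gaussian factors cancel, so a radial Gaussian weight stays radial.\<close>

lemma area_increment_char:
  assumes A [measurable]: "A \<in> borel_measurable (F s)" and st: "0 \<le> s" "s < t" and "\<beta> \<ge> 0"
  defines "h \<equiv> t - s"
  shows "expectation (\<lambda>\<omega>. iexp (u * (A \<omega> + (B s \<omega> $ 1 * (B t \<omega> $ 2 - B s \<omega> $ 2) - B s \<omega> $ 2 * (B t \<omega> $ 1 - B s \<omega> $ 1)) / 2)) *
       of_real (exp (- \<beta> * ((B t \<omega> $ 1)\<^sup>2 + (B t \<omega> $ 2)\<^sup>2) / 2))) =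
    of_real (1 / (1 + \<beta> * h)) *
      expectation (\<lambda>\<omega>. iexp (u * A \<omega>) * of_real (exp (- ((\<beta> + u\<^sup>2 / 4 * h) / (1 + \<beta> * h)) * ((B s \<omega> $ 1)\<^sup>2 + (B s \<omega> $ 2)\<^sup>2) / 2)))"
proof -
  define N where "N = density lborel (normal_density 0 (sqrt h))"
  have "h > 0" using st by (simp add: h_def)
  define D where "D = 1 + \<beta> * h"
  have "D > 0" using \<open>h > 0\<close> \<open>\<beta> \<ge> 0\<close> by (simp add: D_def add_pos_nonneg)
  interpret N: prob_space N
    unfolding N_def using \<open>h > 0\<close> by (intro prob_space_normal_density) auto
  interpret NN: pair_prob_space N N ..
  have [measurable_cong]: "sets N = sets borel" by (simp add: N_def)
  define \<phi> where "\<phi> b v x = of_real (exp (- \<beta> * (b + x)\<^sup>2 / 2)) * iexp (v * x)" for b v x :: real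
  have [measurable]: "\<phi> b v \<in> borel_measurable borel" for b v unfolding \<phi>_def by measurable
  have \<phi>_bound: "norm (\<phi> b v x) \<le> 1" for b v x
    using \<open>\<beta> \<ge> 0\<close> by (simp add: \<phi>_def norm_mult)
  have \<phi>_int: "(CLINT x|N. \<phi> b v x) = of_real (exp (- (\<beta> * b\<^sup>2 + v\<^sup>2 * h) / (2 * D)) / sqrt D) * iexp (- (v * b * (\<beta> * h / D)))" for b v
    unfolding \<phi>_def N_def D_def by (rule gaussian_weighted_char[OF \<open>h > 0\<close> \<open>\<beta> \<ge> 0\<close>])
  define X where "X = (\<lambda>\<omega>. (A \<omega>, B s \<omega> $ 1, B s \<omega> $ 2))"
  \<comment> \<open>With position \<open>(b, c)\<close>, the area grows by half of \<open>b\<close>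
    times the second increment minus \<open>c\<close> times the first; this gives the slopes
    \<open>- u * c / 2\<close> and \<open>u * b / 2\<close>.\<close>
  define g where "g z = (let a = fst (fst z); b = fst (snd (fst z)); c = snd (snd (fst z))
     in iexp (u * a) * (\<phi> b (- u * c / 2) (fst (snd z)) * \<phi> c (u * b / 2) (snd (snd z))))" for z
  have "(\<lambda>\<omega>. B s \<omega> $ i) \<in> borel_measurable (F s)" for i
    by (rule measurable_compose[OF B_measurable_F]) (use st in auto)
  then have X: "X \<in> measurable (F s) (borel \<Otimes>\<^sub>M (borel \<Otimes>\<^sub>M borel))"
    unfolding X_def by measurable
  have g_meas: "g \<in> borel_measurable ((borel \<Otimes>\<^sub>M (borel \<Otimes>\<^sub>M borel)) \<Otimes>\<^sub>M (borel \<Otimes>\<^sub>M borel))"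
    unfolding g_def \<phi>_def Let_def by measurable
  have g_bound: "norm (g z) \<le> 1" for z
    using \<phi>_bound by (auto simp: g_def norm_mult Let_def intro!: mult_le_one)
  have inner: "(CLINT z|N \<Otimes>\<^sub>M N. g ((a, b, c), z)) =
      of_real (1 / D) * (iexp (u * a) * of_real (exp (- ((\<beta> + u\<^sup>2 / 4 * h) / D) * (b\<^sup>2 + c\<^sup>2) / 2)))" for a b c
  proof -
    have "(CLINT z|N \<Otimes>\<^sub>M N. g ((a, b, c), z)) = (CLINT x|N. CLINT y|N. g ((a, b, c), (x, y)))"
      using g_bound g_meas by (intro NN.integral_fst' [symmetric] NN.P.integrable_const_bound[where B = 1]) auto
    also have "\<dots> = iexp (u * a) * ((CLINT x|N. \<phi> b (- u * c / 2) x) * (CLINT y|N. \<phi> c (u * b / 2) y))"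
      by (simp add: g_def Let_def)
    also have "(CLINT x|N. \<phi> b (- u * c / 2) x) * (CLINT y|N. \<phi> c (u * b / 2) y) =
       of_real (exp (- (\<beta> * b\<^sup>2 + (- u * c / 2)\<^sup>2 * h) / (2 * D)) * exp (- (\<beta> * c\<^sup>2 + (u * b / 2)\<^sup>2 * h) / (2 * D)) / (sqrt D * sqrt D)) *
       (iexp (- (- u * c / 2 * b * (\<beta> * h / D))) * iexp (- (u * b / 2 * c * (\<beta> * h / D))))"
      unfolding \<phi>_int of_real_mult of_real_divide by (simp only: times_divide_times_eq times_divide_eq_left times_divide_eq_right divide_divide_eq_left mult_ac)
    also have "iexp (- (- u * c / 2 * b * (\<beta> * h / D))) * iexp (- (u * b / 2 * c * (\<beta> * h / D))) = 1"
      unfolding exp_add [symmetric] by (simp add: mult_ac)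
    \<comment> \<open>The slope for each coordinate is a multiple of the other coordinate, with
      factors of equal modulus, so the new terms add up to \<open>u\<^sup>2 / 4 * h\<close> times
      \<open>b\<^sup>2 + c\<^sup>2\<close>.\<close>
    also have "exp (- (\<beta> * b\<^sup>2 + (- u * c / 2)\<^sup>2 * h) / (2 * D)) * exp (- (\<beta> * c\<^sup>2 + (u * b / 2)\<^sup>2 * h) / (2 * D)) =
      exp (- ((\<beta> + u\<^sup>2 / 4 * h) / D) * (b\<^sup>2 + c\<^sup>2) / 2)"
      unfolding exp_add [symmetric] using \<open>D > 0\<close> by (simp add: field_simps power2_eq_square)
    finally show ?thesis using \<open>D > 0\<close> by (simp add: mult_ac)
  qed
  have "(\<lambda>\<omega>. iexp (u * (A \<omega> + (B s \<omega> $ 1 * (B t \<omega> $ 2 - B s \<omega> $ 2) - B s \<omega> $ 2 * (B t \<omega> $ 1 - B s \<omega> $ 1)) / 2)) *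
       of_real (exp (- \<beta> * ((B t \<omega> $ 1)\<^sup>2 + (B t \<omega> $ 2)\<^sup>2) / 2))) =
     (\<lambda>\<omega>. g (X \<omega>, (B t \<omega> $ 1 - B s \<omega> $ 1, B t \<omega> $ 2 - B s \<omega> $ 2)))"
  proof
    fix \<omega>
    have "exp (- \<beta> * ((B t \<omega> $ 1)\<^sup>2 + (B t \<omega> $ 2)\<^sup>2) / 2) = exp (- \<beta> * (B t \<omega> $ 1)\<^sup>2 / 2) * exp (- \<beta> * (B t \<omega> $ 2)\<^sup>2 / 2)"
      by (simp add: exp_add [symmetric] field_simps)
    moreover have "iexp (u * (A \<omega> + (B s \<omega> $ 1 * (B t \<omega> $ 2 - B s \<omega> $ 2) - B s \<omega> $ 2 * (B t \<omega> $ 1 - B s \<omega> $ 1)) / 2)) =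
      iexp (u * A \<omega>) * (iexp (- u * B s \<omega> $ 2 / 2 * (B t \<omega> $ 1 - B s \<omega> $ 1)) * iexp (u * B s \<omega> $ 1 / 2 * (B t \<omega> $ 2 - B s \<omega> $ 2)))"
      unfolding exp_add [symmetric] by (simp add: field_simps)
    ultimately show "iexp (u * (A \<omega> + (B s \<omega> $ 1 * (B t \<omega> $ 2 - B s \<omega> $ 2) - B s \<omega> $ 2 * (B t \<omega> $ 1 - B s \<omega> $ 1)) / 2)) *
       of_real (exp (- \<beta> * ((B t \<omega> $ 1)\<^sup>2 + (B t \<omega> $ 2)\<^sup>2) / 2)) =
       g (X \<omega>, (B t \<omega> $ 1 - B s \<omega> $ 1, B t \<omega> $ 2 - B s \<omega> $ 2))"
      by (simp only: g_def X_def \<phi>_def Let_def fst_conv snd_conv) (simp add: mult_ac)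
  qed
  then show ?thesis
    using expectation_indep_increment[OF X st g_meas g_bound, folded h_def, folded N_def]
    by (simp add: X_def inner D_def)
qed

end

text \<open>The quotient \<open>\<beta> = area_numer / area_denom\<close> obeys the recursion
  \<open>\<beta> \<mapsto> (\<beta> + u\<^sup>2 h / 4) / (1 + \<beta> h)\<close> for the radial weight in \<open>area_increment_char\<close>.\<close>

fun area_numer :: "real \<Rightarrow> real \<Rightarrow> nat \<Rightarrow> real" and area_denom :: "real \<Rightarrow> real \<Rightarrow> nat \<Rightarrow> real" where
  "area_numer u h 0 = 0"
| "area_denom u h 0 = 1"
| "area_numer u h (Suc k) = area_numer u h k + u\<^sup>2 / 4 * h * area_denom u h k"
| "area_denom u h (Suc k) = area_denom u h k + h * area_numer u h k"

lemma area_numer_denom_pos: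
  assumes "h \<ge> 0"
  shows "area_numer u h k \<ge> 0 \<and> area_denom u h k > 0"
  using assms by (induction k) (auto intro!: add_nonneg_nonneg add_pos_nonneg)

text \<open>The recursion is linear with eigenvalues \<open>1 + u * h / 2\<close> and
  \<open>1 - u * h / 2\<close>: for nonzero \<open>u\<close>, the combinations
  \<open>area_denom\<close> plus or minus \<open>2 / u\<close> times \<open>area_numer\<close> are
  multiplied by them at each step.\<close>

lemma area_denom_eq:
  "area_denom u h k = ((1 + u * h / 2) ^ k + (1 - u * h / 2) ^ k) / 2 \<and>
   area_numer u h k = u / 2 * (((1 + u * h / 2) ^ k - (1 - u * h / 2) ^ k) / 2)"
proof (induction k)
  case (Suc k)
  define a b where "a = (1 + u * h / 2) ^ k" and "b = (1 - u * h / 2) ^ k"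
  have IH: "area_denom u h k = (a + b) / 2" "area_numer u h k = u / 2 * ((a - b) / 2)"
    using Suc.IH by (simp_all add: a_def b_def)
  show ?case
    unfolding area_denom.simps area_numer.simps power_Suc IH a_def[symmetric] b_def[symmetric]
    by (simp add: field_simps power2_eq_square)
qed simp

lemma area_denom_tendsto:
  "(\<lambda>n. area_denom u (T / Suc n) (Suc n)) \<longlonglongrightarrow> cosh (T * u / 2)"
proof -
  have 1: "(\<lambda>n. (1 + x / Suc n) ^ Suc n) \<longlonglongrightarrow> exp x" for x :: real
    using LIMSEQ_Suc[OF tendsto_exp_limit_sequentially[of x]] .
  have "(\<lambda>n. ((1 + (T * u / 2) / Suc n) ^ Suc n + (1 + (- (T * u / 2)) / Suc n) ^ Suc n) / 2)
    \<longlonglongrightarrow> (exp (T * u / 2) + exp (- (T * u / 2))) / 2"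
    by (intro tendsto_intros 1) simp
  moreover have "1 + u * (T / Suc n) / 2 = 1 + (T * u / 2) / Suc n"
    "1 - u * (T / Suc n) / 2 = 1 + (- (T * u / 2)) / Suc n" for n
    by (simp_all add: mult_ac)
  ultimately show ?thesis
    unfolding area_denom_eq[THEN conjunct1] cosh_field_def by (simp only:)
qed

section \<open>The discrete area and its distance from the Ito area\<close>

context brownian_plane
begin

definition discrete_area :: "real \<Rightarrow> nat \<Rightarrow> 'a \<Rightarrow> real" where
  "discrete_area h n \<omega> = (riemann_sum 2 1 h n \<omega> - riemann_sum 1 2 h n \<omega>) / 2"

lemma discrete_area_0: "discrete_area h 0 \<omega> = 0"
  by (simp add: discrete_area_def riemann_sum_def)

lemma discrete_area_Suc:
  "discrete_area h (Suc n) \<omega> = discrete_area h n \<omega> +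
    (B (real n * h) \<omega> $ 1 * (B (real (Suc n) * h) \<omega> $ 2 - B (real n * h) \<omega> $ 2)
     - B (real n * h) \<omega> $ 2 * (B (real (Suc n) * h) \<omega> $ 1 - B (real n * h) \<omega> $ 1)) / 2"
  by (simp add: discrete_area_def riemann_sum_def diff_divide_distrib add_divide_distrib)

lemma discrete_area_adapted:
  assumes "h \<ge> 0"
  shows "discrete_area h n \<in> borel_measurable (F (real n * h))"
proof (induction n)
  case (Suc n)
  have [measurable]: "(\<lambda>\<omega>. B (real n * h) \<omega> $ i) \<in> borel_measurable (F (real (Suc n) * h))"
    "(\<lambda>\<omega>. B (real (Suc n) * h) \<omega> $ i) \<in> borel_measurable (F (real (Suc n) * h))" for i
    using assms by (auto intro!: B_nth_measurable_F mult_right_mono)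
  have [measurable]: "discrete_area h n \<in> borel_measurable (F (real (Suc n) * h))"
    by (rule measurable_F_mono[OF Suc.IH]) (use assms in \<open>auto intro!: mult_right_mono\<close>)
  show ?case unfolding discrete_area_Suc[abs_def] by measurable
qed (simp add: discrete_area_0[abs_def])

text \<open>Induction on the number \<open>k\<close> of increments already integrated out, counted
  from the end. The factors telescope, since \<open>1 + \<beta> * h\<close> is the quotient of
  consecutive values of \<open>area_denom\<close>.\<close>

lemma discrete_area_char_step:
  assumes "h > 0" "k \<le> n"
  shows "expectation (\<lambda>\<omega>. iexp (u * discrete_area h n \<omega>)) =
    of_real (1 / area_denom u h k) *
    expectation (\<lambda>\<omega>. iexp (u * discrete_area h (n - k) \<omega>) * of_real (exp (- (area_numer u h k / area_denom u h k) *
      ((B (real (n - k) * h) \<omega> $ 1)\<^sup>2 + (B (real (n - k) * h) \<omega> $ 2)\<^sup>2) / 2)))"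
  using \<open>k \<le> n\<close>
proof (induction k)
  case (Suc k)
  define l where "l = n - Suc k"
  have l: "n - k = Suc l" using Suc.prems by (simp add: l_def)
  define p q where "p = area_denom u h k" and "q = area_numer u h k"
  have pq: "p > 0" "q \<ge> 0" using area_numer_denom_pos[of h u k] \<open>h > 0\<close> by (auto simp: p_def q_def)
  have h: "real (Suc l) * h - real l * h = h" by (simp add: algebra_simps)
  have "p + h * q > 0" using pq \<open>h > 0\<close> by (intro add_pos_nonneg) auto
  have "expectation (\<lambda>\<omega>. iexp (u * discrete_area h n \<omega>)) =
     of_real (1 / p) * expectation (\<lambda>\<omega>. iexp (u * discrete_area h (Suc l) \<omega>) * of_real (exp (- (q / p) *
      ((B (real (Suc l) * h) \<omega> $ 1)\<^sup>2 + (B (real (Suc l) * h) \<omega> $ 2)\<^sup>2) / 2)))"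
    using Suc by (simp add: l p_def q_def)
  also have "\<dots> = of_real (1 / p) * (of_real (1 / (1 + q / p * h)) *
     expectation (\<lambda>\<omega>. iexp (u * discrete_area h l \<omega>) * of_real (exp (- ((q / p + u\<^sup>2 / 4 * h) / (1 + q / p * h)) *
      ((B (real l * h) \<omega> $ 1)\<^sup>2 + (B (real l * h) \<omega> $ 2)\<^sup>2) / 2))))"
    unfolding discrete_area_Suc
    by (subst area_increment_char[where s = "real l * h" and t = "real (Suc l) * h", unfolded h])
       (use pq \<open>h > 0\<close> in \<open>auto intro!: discrete_area_adapted mult_strict_right_mono\<close>)
  also have "(q / p + u\<^sup>2 / 4 * h) / (1 + q / p * h) = area_numer u h (Suc k) / area_denom u h (Suc k)"
    using pq \<open>p + h * q > 0\<close> by (simp add: p_def[symmetric] q_def[symmetric] divide_simps) (simp add: algebra_simps)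
  also have "of_real (1 / p) * (of_real (1 / (1 + q / p * h)) * z) = of_real (1 / area_denom u h (Suc k)) * z" for z :: complex
  proof -
    have "1 / p * (1 / (1 + q / p * h)) = 1 / area_denom u h (Suc k)"
      using pq \<open>p + h * q > 0\<close> by (simp add: p_def[symmetric] q_def[symmetric] divide_simps) (simp add: algebra_simps)
    then show ?thesis by (simp only: mult.assoc [symmetric] of_real_mult [symmetric])
  qed
  finally show ?case by (simp only: l_def)
qed simp

lemma char_discrete_area:
  assumes "h > 0"
  shows "expectation (\<lambda>\<omega>. iexp (u * discrete_area h n \<omega>)) = of_real (1 / area_denom u h n)"
proof -
  \<comment> \<open>With all increments removed, the position is \<open>B 0\<close>, almost surely
    the origin, where the radial weight equals 1.\<close>
  have "expectation (\<lambda>\<omega>. iexp (u * discrete_area h 0 \<omega>) * of_real (exp (- (area_numer u h n / area_denom u h n) *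
      ((B (real 0 * h) \<omega> $ 1)\<^sup>2 + (B (real 0 * h) \<omega> $ 2)\<^sup>2) / 2))) = expectation (\<lambda>\<omega>. 1 :: complex)"
    using AE_B_0 by (intro integral_cong_AE) (auto simp: discrete_area_0 elim!: eventually_mono)
  then show ?thesis
    using discrete_area_char_step[OF assms order_refl, of u n] by (simp add: prob_space)
qed

text \<open>Each integral contributes at most \<open>4 * T * h\<close>; by convexity of the square,
  half the difference of the two errors satisfies the same bound.\<close>

lemma discrete_area_error:
  assumes "h > 0" "real n * h = T"
    and I: "has_ito_integral M F (\<lambda>t \<omega>. B t \<omega> $ 2) T (\<lambda>t \<omega>. B t \<omega> $ 1) I"
    and J: "has_ito_integral M F (\<lambda>t \<omega>. B t \<omega> $ 1) T (\<lambda>t \<omega>. B t \<omega> $ 2) J"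
    and S: "S \<in> borel_measurable M" "AE \<omega> in M. S \<omega> = 1 / 2 * (I \<omega> - J \<omega>)"
  shows "(\<integral>\<^sup>+\<omega>. ennreal ((discrete_area h n \<omega> - S \<omega>)\<^sup>2) \<partial>M) \<le> ennreal (4 * T * h)"
proof -
  have [measurable]: "I \<in> borel_measurable M" "J \<in> borel_measurable M"
    using I J by (auto simp: has_ito_integral_def)
  have [measurable]: "(\<lambda>\<omega>. B (real k * h) \<omega> $ q) \<in> borel_measurable M" "(\<lambda>\<omega>. B ((1 + real k) * h) \<omega> $ q) \<in> borel_measurable M" for k q
    using \<open>h > 0\<close> by auto
  have [measurable]: "riemann_sum i j h n \<in> borel_measurable M" for i j
    unfolding riemann_sum_def by simp
  have "T \<ge> 0" using assms(1,2) by auto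
  define e1 e2 where "e1 \<omega> = riemann_sum 2 1 h n \<omega> - I \<omega>" and "e2 \<omega> = riemann_sum 1 2 h n \<omega> - J \<omega>" for \<omega>
  have [measurable]: "e1 \<in> borel_measurable M" "e2 \<in> borel_measurable M"
    unfolding e1_def e2_def by measurable
  have "(\<integral>\<^sup>+\<omega>. ennreal ((discrete_area h n \<omega> - S \<omega>)\<^sup>2) \<partial>M) = (\<integral>\<^sup>+\<omega>. ennreal (((e1 \<omega> - e2 \<omega>) / 2)\<^sup>2) \<partial>M)"
  proof (rule nn_integral_cong_AE, use S(2) in eventually_elim)
    fix \<omega> assume "S \<omega> = 1 / 2 * (I \<omega> - J \<omega>)"
    then have "discrete_area h n \<omega> - S \<omega> = (e1 \<omega> - e2 \<omega>) / 2"
      by (simp add: discrete_area_def e1_def e2_def field_simps)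
    then show "ennreal ((discrete_area h n \<omega> - S \<omega>)\<^sup>2) = ennreal (((e1 \<omega> - e2 \<omega>) / 2)\<^sup>2)"
      by (simp only:)
  qed
  also have "\<dots> \<le> (\<integral>\<^sup>+\<omega>. ennreal (1 / 2) * ennreal ((e1 \<omega>)\<^sup>2) + ennreal (1 / 2) * ennreal ((e2 \<omega>)\<^sup>2) \<partial>M)"
  proof (intro nn_integral_mono)
    fix \<omega>
    have "((e1 \<omega> - e2 \<omega>) / 2)\<^sup>2 \<le> 1 / 2 * (e1 \<omega>)\<^sup>2 + 1 / 2 * (e2 \<omega>)\<^sup>2"
      using zero_le_power2[of "e1 \<omega> + e2 \<omega>"] by (simp add: power2_eq_square field_simps)
    then have "ennreal (((e1 \<omega> - e2 \<omega>) / 2)\<^sup>2) \<le> ennreal (1 / 2 * (e1 \<omega>)\<^sup>2 + 1 / 2 * (e2 \<omega>)\<^sup>2)"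
      by (rule ennreal_leI)
    also have "\<dots> = ennreal (1 / 2 * (e1 \<omega>)\<^sup>2) + ennreal (1 / 2 * (e2 \<omega>)\<^sup>2)"
      by (rule ennreal_plus) auto
    also have "\<dots> = ennreal (1 / 2) * ennreal ((e1 \<omega>)\<^sup>2) + ennreal (1 / 2) * ennreal ((e2 \<omega>)\<^sup>2)"
      by (intro arg_cong2[where f = plus] ennreal_mult') auto
    finally show "ennreal (((e1 \<omega> - e2 \<omega>) / 2)\<^sup>2) \<le> ennreal (1 / 2) * ennreal ((e1 \<omega>)\<^sup>2) + ennreal (1 / 2) * ennreal ((e2 \<omega>)\<^sup>2)" .
  qed
  also have "\<dots> = ennreal (1 / 2) * (\<integral>\<^sup>+\<omega>. ennreal ((e1 \<omega>)\<^sup>2) \<partial>M) + ennreal (1 / 2) * (\<integral>\<^sup>+\<omega>. ennreal ((e2 \<omega>)\<^sup>2) \<partial>M)"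
    by (simp add: nn_integral_add nn_integral_cmult)
  also have "\<dots> \<le> ennreal (1 / 2) * (4 * ennreal (T * h)) + ennreal (1 / 2) * (4 * ennreal (T * h))"
    unfolding e1_def e2_def by (intro add_mono mult_left_mono riemann_sum_error assms) auto
  also have "4 * ennreal (T * h) = ennreal (4 * (T * h))"
    using \<open>T \<ge> 0\<close> \<open>h > 0\<close> by (simp add: ennreal_mult)
  also have "ennreal (1 / 2) * ennreal (4 * (T * h)) = ennreal (2 * (T * h))"
    by (subst ennreal_mult' [symmetric]) simp_all
  also have "ennreal (2 * (T * h)) + ennreal (2 * (T * h)) = ennreal (4 * T * h)"
    using \<open>T \<ge> 0\<close> \<open>h > 0\<close> by (subst ennreal_plus [symmetric]) simp_all
  finally show ?thesis .
qed

text \<open>The map \<open>iexp\<close> is 1-Lipschitz, so characteristic functions differ by at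
  most \<open>\<bar>u\<bar>\<close> times the L1 distance, which the L2 distance controls.\<close>

lemma norm_char_diff_le:
  assumes [measurable]: "X \<in> borel_measurable M" "Y \<in> borel_measurable M"
    and e: "(\<integral>\<^sup>+\<omega>. ennreal ((X \<omega> - Y \<omega>)\<^sup>2) \<partial>M) \<le> ennreal (e\<^sup>2)" "e > 0"
  shows "norm (expectation (\<lambda>\<omega>. iexp (u * X \<omega>)) - expectation (\<lambda>\<omega>. iexp (u * Y \<omega>))) \<le> \<bar>u\<bar> * e"
proof -
  have sq: "integrable M (\<lambda>\<omega>. (X \<omega> - Y \<omega>)\<^sup>2)"
    using e(1) by (intro integrableI_nonneg) (auto intro: le_less_trans)
  have abs: "integrable M (\<lambda>\<omega>. \<bar>X \<omega> - Y \<omega>\<bar>)"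
    using square_integrable_imp_integrable[OF _ sq] by simp
  have int: "integrable M (\<lambda>\<omega>. iexp (u * Z \<omega>))" if [measurable]: "Z \<in> borel_measurable M" for Z
    by (rule integrable_const_bound[where B = 1]) auto
  have "ennreal (expectation (\<lambda>\<omega>. (X \<omega> - Y \<omega>)\<^sup>2)) \<le> ennreal (e\<^sup>2)"
    using e(1) sq by (simp add: nn_integral_eq_integral)
  then have sq_le: "expectation (\<lambda>\<omega>. (X \<omega> - Y \<omega>)\<^sup>2) \<le> e\<^sup>2" by simp
  \<comment> \<open>Twice a product is at most the sum of the squares; divided by
    \<open>2 * e\<close>, this plays the part of the Cauchy-Schwarz inequality.\<close>
  have "expectation (\<lambda>\<omega>. \<bar>X \<omega> - Y \<omega>\<bar>) \<le> expectation (\<lambda>\<omega>. ((X \<omega> - Y \<omega>)\<^sup>2 / e + e) / 2)"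
  proof (rule integral_mono[OF abs])
    show "integrable M (\<lambda>\<omega>. ((X \<omega> - Y \<omega>)\<^sup>2 / e + e) / 2)" using sq by simp
    show "\<bar>X \<omega> - Y \<omega>\<bar> \<le> ((X \<omega> - Y \<omega>)\<^sup>2 / e + e) / 2" for \<omega>
      using sum_squares_bound[of "\<bar>X \<omega> - Y \<omega>\<bar>" e] \<open>e > 0\<close> by (simp add: field_simps power2_eq_square[of e])
  qed
  also have "\<dots> = (expectation (\<lambda>\<omega>. (X \<omega> - Y \<omega>)\<^sup>2) / e + e) / 2"
    using sq by (simp add: prob_space)
  also have "\<dots> \<le> (e\<^sup>2 / e + e) / 2"
    using sq_le \<open>e > 0\<close> by (simp add: divide_right_mono)
  also have "\<dots> = e" using \<open>e > 0\<close> by (simp add: power2_eq_square)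
  finally have abs_le: "expectation (\<lambda>\<omega>. \<bar>X \<omega> - Y \<omega>\<bar>) \<le> e" .
  have lip: "norm (iexp x - iexp y) \<le> \<bar>x - y\<bar>" for x y :: real
  proof -
    have "iexp x - iexp y = iexp y * (iexp (x - y) - 1)"
      by (simp add: algebra_simps exp_add [symmetric])
    also have "norm \<dots> = norm (iexp (x - y) - 1)" by (simp add: norm_mult)
    also have "\<dots> \<le> \<bar>x - y\<bar>" using iexp_approx1[of "x - y" 0] by simp
    finally show ?thesis .
  qed
  have "norm (expectation (\<lambda>\<omega>. iexp (u * X \<omega>)) - expectation (\<lambda>\<omega>. iexp (u * Y \<omega>))) =
      norm (expectation (\<lambda>\<omega>. iexp (u * X \<omega>) - iexp (u * Y \<omega>)))"
    by (subst Bochner_Integration.integral_diff[OF int[OF assms(1)] int[OF assms(2)]]) (rule refl)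
  also have "\<dots> \<le> expectation (\<lambda>\<omega>. norm (iexp (u * X \<omega>) - iexp (u * Y \<omega>)))"
    by (rule integral_norm_bound)
  also have "\<dots> \<le> expectation (\<lambda>\<omega>. \<bar>u\<bar> * \<bar>X \<omega> - Y \<omega>\<bar>)"
  proof (rule integral_mono)
    show "integrable M (\<lambda>\<omega>. norm (iexp (u * X \<omega>) - iexp (u * Y \<omega>)))"
      by (intro integrable_norm Bochner_Integration.integrable_diff int) auto
    show "integrable M (\<lambda>\<omega>. \<bar>u\<bar> * \<bar>X \<omega> - Y \<omega>\<bar>)" using abs by simp
    show "norm (iexp (u * X \<omega>) - iexp (u * Y \<omega>)) \<le> \<bar>u\<bar> * \<bar>X \<omega> - Y \<omega>\<bar>" for \<omega>
      using lip[of "u * X \<omega>" "u * Y \<omega>"] by (simp add: abs_mult [symmetric] right_diff_distrib)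
  qed
  also have "\<dots> = \<bar>u\<bar> * expectation (\<lambda>\<omega>. \<bar>X \<omega> - Y \<omega>\<bar>)" by simp
  also have "\<dots> \<le> \<bar>u\<bar> * e" using abs_le by (intro mult_left_mono) auto
  finally show ?thesis .
qed

end

theorem char_levy_area:
  assumes "levy_area M B T S" "T > 0"
  shows "char (distr M borel S) u = 1 / cosh (T * u / 2)"
proof -
  interpret brownian_plane M B
    using assms by (auto simp: levy_area_def brownian_motion_def brownian_plane_def brownian_plane_axioms_def)
  have S [measurable]: "S \<in> borel_measurable M"
    using assms by (simp add: levy_area_def)
  obtain I J where IJ:
      "has_ito_integral M F (\<lambda>t \<omega>. B t \<omega> $ 2) T (\<lambda>t \<omega>. B t \<omega> $ 1) I"
      "has_ito_integral M F (\<lambda>t \<omega>. B t \<omega> $ 1) T (\<lambda>t \<omega>. B t \<omega> $ 2) J"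
    and S_eq: "AE \<omega> in M. S \<omega> = 1 / 2 * (I \<omega> - J \<omega>)"
    using assms unfolding levy_area_def by blast
  \<comment> \<open>Counting \<open>Suc n\<close> intervals keeps the mesh positive at
    \<open>n = 0\<close>.\<close>
  define h where "h n = T / Suc n" for n
  have h: "h n > 0" "real (Suc n) * h n = T" for n
    using \<open>T > 0\<close> by (simp_all add: h_def)
  define e where "e n = sqrt (4 * T * h n)" for n
  have e: "e n > 0" for n using h \<open>T > 0\<close> by (simp add: e_def)
  have bound: "norm (of_real (1 / area_denom u (h n) (Suc n)) - char (distr M borel S) u) \<le> \<bar>u\<bar> * e n" for n
  proof -
    have "discrete_area (h n) (Suc n) \<in> borel_measurable M"
      by (rule measurable_F_imp[OF discrete_area_adapted]) (use h[of n] in auto)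
    moreover have "(\<integral>\<^sup>+\<omega>. ennreal ((discrete_area (h n) (Suc n) \<omega> - S \<omega>)\<^sup>2) \<partial>M) \<le> ennreal ((e n)\<^sup>2)"
      using discrete_area_error[OF h IJ S S_eq, of n] h[of n] \<open>T > 0\<close> by (simp add: e_def)
    ultimately have "norm (expectation (\<lambda>\<omega>. iexp (u * discrete_area (h n) (Suc n) \<omega>)) - expectation (\<lambda>\<omega>. iexp (u * S \<omega>))) \<le> \<bar>u\<bar> * e n"
      using S e by (intro norm_char_diff_le)
    then show ?thesis
      unfolding char_discrete_area[OF h(1)] char_def by (subst integral_distr) auto
  qed
  have "(\<lambda>n. sqrt (4 * T * (T / Suc n))) \<longlonglongrightarrow> sqrt (4 * T * 0)"
    by (intro tendsto_intros LIMSEQ_Suc[OF lim_const_over_n])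
  then have "(\<lambda>n. \<bar>u\<bar> * e n) \<longlonglongrightarrow> 0"
    unfolding e_def h_def using tendsto_mult_right_zero by fastforce
  then have "(\<lambda>n. of_real (1 / area_denom u (h n) (Suc n)) - char (distr M borel S) u) \<longlonglongrightarrow> 0"
    by (rule Lim_null_comparison[rotated]) (use bound in auto)
  then have "(\<lambda>n. of_real (1 / area_denom u (h n) (Suc n))) \<longlonglongrightarrow> char (distr M borel S) u"
    by (rule LIM_zero_cancel)
  moreover have "(\<lambda>n. of_real (1 / area_denom u (h n) (Suc n))) \<longlonglongrightarrow> complex_of_real (1 / cosh (T * u / 2))"
    unfolding h_def by (intro tendsto_intros area_denom_tendsto) (simp add: cosh_real_pos less_imp_neq[symmetric])
  ultimately show ?thesis
    using LIMSEQ_unique by auto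
qed

subsection \<open>Tail of the norm\<close>

lemma abs_component_le_lp_norm:
  fixes v :: "real ^ 'n::finite"
  assumes "1 \<le> p"
  shows "\<bar>v $ i\<bar> \<le> lp_norm p v"
proof (cases "p = \<infinity>")
  case True
  then show ?thesis by (simp add: lp_norm_def component_le_infnorm_cart)
next
  case False
  then obtain r where r: "p = ereal r" "r \<ge> 1" using assms by (cases p) auto
  have "\<bar>v $ i\<bar> = (\<bar>v $ i\<bar> powr r) powr (1 / r)"
    using r by (simp add: powr_powr)
  also have "\<dots> \<le> (\<Sum>i\<in>UNIV. \<bar>v $ i\<bar> powr r) powr (1 / r)"
    using r by (intro powr_mono2 member_le_sum) auto
  finally show ?thesis using r by (simp add: lp_norm_def)
qed

text \<open>Each modulus is at most the sum \<open>s\<close>, so its power \<open>r\<close> is at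
  most the modulus times \<open>s powr (r - 1)\<close>, as \<open>r \<ge> 1\<close>; summation gives
  \<open>s powr r\<close>. The case of the maximum norm passes through the Euclidean norm.\<close>

lemma lp_norm_le_sum_abs:
  fixes v :: "real ^ 'n::finite"
  assumes "1 \<le> p"
  shows "lp_norm p v \<le> (\<Sum>i\<in>UNIV. \<bar>v $ i\<bar>)"
proof (cases "p = \<infinity>")
  case True
  then show ?thesis
    using infnorm_le_norm[of v] norm_le_l1_cart[of v] by (simp add: lp_norm_def)
next
  case False
  then obtain r where r: "p = ereal r" "r \<ge> 1" using assms by (cases p) auto
  define s where "s = (\<Sum>i\<in>UNIV. \<bar>v $ i\<bar>)"
  have le: "\<bar>v $ i\<bar> \<le> s" for i unfolding s_def by (intro member_le_sum) auto
  have "s \<ge> 0" by (auto simp: s_def intro: sum_nonneg)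
  have "\<bar>v $ i\<bar> powr r \<le> \<bar>v $ i\<bar> * s powr (r - 1)" for i
  proof (cases "v $ i = 0")
    case nz: False
    have "\<bar>v $ i\<bar> powr r = \<bar>v $ i\<bar> * \<bar>v $ i\<bar> powr (r - 1)"
      using nz by (simp add: powr_diff)
    also have "\<dots> \<le> \<bar>v $ i\<bar> * s powr (r - 1)"
      using r le by (intro mult_left_mono powr_mono2) auto
    finally show ?thesis .
  qed simp
  then have "(\<Sum>i\<in>UNIV. \<bar>v $ i\<bar> powr r) \<le> s * s powr (r - 1)"
    unfolding s_def sum_distrib_right by (intro sum_mono)
  also have "s * s powr (r - 1) = s powr r"
    using \<open>s \<ge> 0\<close> by (cases "s = 0") (auto simp: powr_diff)
  finally have "(\<Sum>i\<in>UNIV. \<bar>v $ i\<bar> powr r) powr (1 / r) \<le> (s powr r) powr (1 / r)"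
    using r by (intro powr_mono2) (auto intro: sum_nonneg)
  also have "\<dots> = s" using r \<open>s \<ge> 0\<close> by (simp add: powr_powr)
  finally show ?thesis using r by (simp add: lp_norm_def s_def)
qed

lemma measurable_lp_norm:
  assumes "\<And>i. X i \<in> borel_measurable M"
  shows "(\<lambda>\<omega>. lp_norm p (\<chi> i::'n::finite. X i \<omega>)) \<in> borel_measurable M"
proof (cases "p = \<infinity>")
  case True
  have "(\<lambda>\<omega>. (\<chi> i::'n. X i \<omega>) \<bullet> b) \<in> borel_measurable M" if "b \<in> Basis" for b
    using that assms by (auto simp: Basis_vec_def inner_axis)
  then have "(\<lambda>\<omega>. \<chi> i::'n. X i \<omega>) \<in> borel_measurable M"
    by (subst borel_measurable_euclidean_space) auto
  moreover have "infnorm \<in> borel_measurable (borel :: (real ^ 'n) measure)"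
    by (intro borel_measurable_continuous_onI continuous_at_imp_continuous_on ballI continuous_infnorm) simp
  ultimately show ?thesis using True by (simp add: lp_norm_def)
next
  case False
  note [measurable] = assms
  show ?thesis using False unfolding lp_norm_def by simp
qed

text \<open>Constant prefactors vanish after taking logarithms and dividing by \<open>x\<close>. The
  upper bound is required only for exponents below \<open>r\<close>, because exponential moments are
  available only there.\<close>

lemma tendsto_ln_tail:
  fixes P :: "real \<Rightarrow> real"
  assumes lower: "\<exists>C>0. \<forall>x\<ge>0. C * exp (- r * x) \<le> P x"
    and upper: "\<And>l. 0 \<le> l \<Longrightarrow> l < r \<Longrightarrow> \<exists>K. \<forall>x\<ge>0. P x \<le> K * exp (- l * x)"
    and "r > 0"
  shows "((\<lambda>x. ln (P x) / x) \<longlongrightarrow> - r) at_top"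
proof -
  obtain C where C: "C > 0" "\<And>x. x \<ge> 0 \<Longrightarrow> C * exp (- r * x) \<le> P x"
    using lower by blast
  have pos: "P x > 0" if "x \<ge> 0" for x
    using C(2)[OF that] mult_pos_pos[OF C(1) exp_gt_zero[of "- r * x"]] by linarith
  have lim: "((\<lambda>x::real. ln a / x - b) \<longlongrightarrow> - b) at_top" for a b :: real
  proof -
    have "((\<lambda>x::real. ln a / x - b) \<longlongrightarrow> 0 - b) at_top"
      by (intro tendsto_diff tendsto_const tendsto_divide_0[OF tendsto_const]
          filterlim_at_top_imp_at_infinity filterlim_ident)
    then show ?thesis by simp
  qed
  show ?thesis
  proof (rule order_tendstoI)
    fix a assume "a < - r"
    have "eventually (\<lambda>x. a < ln C / x - r) at_top"
      using order_tendstoD(1)[OF lim \<open>a < - r\<close>] .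
    then show "eventually (\<lambda>x. a < ln (P x) / x) at_top"
      using eventually_gt_at_top[of 0]
    proof eventually_elim
      case (elim x)
      have "ln (C * exp (- r * x)) \<le> ln (P x)"
        using C(1) C(2)[of x] elim pos[of x] by (intro ln_mono) auto
      then have "(ln C - r * x) / x \<le> ln (P x) / x"
        using C elim by (intro divide_right_mono) (auto simp: ln_mult)
      then show ?case using elim by (simp add: diff_divide_distrib)
    qed
  next
    fix a assume "- r < a"
    \<comment> \<open>The midpoint of \<open>- a\<close> and \<open>r\<close>, cut off at 0 in case
      \<open>a\<close> exceeds \<open>r\<close>.\<close>
    define l where "l = max 0 ((r - a) / 2)"
    have l: "0 \<le> l" "l < r" "- l < a" using \<open>- r < a\<close> \<open>r > 0\<close> by (auto simp: l_def max_def field_simps)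
    obtain K where K: "\<And>x. x \<ge> 0 \<Longrightarrow> P x \<le> K * exp (- l * x)" using upper[OF l(1,2)] by blast
    have "K > 0" using pos[of 0] K[of 0] by simp
    have "eventually (\<lambda>x. ln K / x - l < a) at_top"
      using order_tendstoD(2)[OF lim l(3)] .
    then show "eventually (\<lambda>x. ln (P x) / x < a) at_top"
      using eventually_gt_at_top[of 0]
    proof eventually_elim
      case (elim x)
      have "ln (P x) \<le> ln (K * exp (- l * x))"
        using K[of x] elim pos[of x] by (intro ln_mono) auto
      then have "ln (P x) / x \<le> (ln K - l * x) / x"
        using \<open>K > 0\<close> elim by (intro divide_right_mono) (auto simp: ln_mult)
      then show ?case using elim by (simp add: diff_divide_distrib)
    qed
  qed
qed

theorem corollary4p10:
  fixes M :: "'a measure" and N :: "'b measure"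
    and B :: "real \<Rightarrow> 'b \<Rightarrow> real ^ 2" and S :: "'b \<Rightarrow> real"
    and X :: "'n::finite \<Rightarrow> 'a \<Rightarrow> real"
    and T :: real and p :: ereal
  assumes "T > 0" and "1 \<le> p"
    and "levy_area N B T S"
    and "prob_space M"
    and "prob_space.indep_vars M (\<lambda>_. borel) X UNIV"
    and "\<And>i. distr M borel (X i) = distr N borel S"
  shows "((\<lambda>x. ln (measure M {\<omega> \<in> space M. lp_norm p (\<chi> i. X i \<omega>) \<ge> x}) / x)
            \<longlongrightarrow> - (pi / T)) at_top"
proof -
  interpret prob_space M by fact
  \<comment> \<open>Makes \<open>pi * c * u\<close> equal to \<open>T * u / 2\<close>, so that the
    characteristic functions agree; the tail rate \<open>1 / (2 * c)\<close> is then
    \<open>pi / T\<close>.\<close>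
  define c where "c = T / (2 * pi)"
  have c: "c > 0" "1 / (2 * c) = pi / T" using \<open>T > 0\<close> by (simp_all add: c_def)
  have X [measurable]: "X i \<in> borel_measurable M" for i
    using assms(5) by (auto simp: indep_vars_def)
  have law: "distr M borel (X i) = log_ratio c" for i
  proof (rule Levy_uniqueness)
    show "real_distribution (distr M borel (X i))"
      by (intro real_distribution_distr X)
    show "char (distr M borel (X i)) = char (log_ratio c)"
      using \<open>T > 0\<close> unfolding assms(6)
      by (auto simp: fun_eq_iff char_levy_area[OF assms(3,1)] char_log_ratio c_def)
  qed (rule real_distribution_log_ratio)
  define P where "P x = measure M {\<omega> \<in> space M. lp_norm p (\<chi> i. X i \<omega>) \<ge> x}" for x
  have [measurable]: "(\<lambda>\<omega>. lp_norm p (\<chi> i. X i \<omega>)) \<in> borel_measurable M"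
    by (rule measurable_lp_norm) (rule X)
  have "((\<lambda>x. ln (P x) / x) \<longlongrightarrow> - (pi / T)) at_top"
  proof (rule tendsto_ln_tail)
    obtain C where C: "C > 0" "\<And>x. x \<ge> 0 \<Longrightarrow> measure (log_ratio c) {y. x \<le> y} \<ge> C * exp (- x / (2 * c))"
      using measure_log_ratio_ge[OF c(1)] by blast
    show "\<exists>C>0. \<forall>x\<ge>0. C * exp (- (pi / T) * x) \<le> P x"
    proof (intro exI[of _ C] conjI allI impI C(1))
      fix x :: real assume "x \<ge> 0"
      \<comment> \<open>Any component serves for the lower bound; index types are nonempty.\<close>
      define i :: 'n where "i = undefined"
      have "C * exp (- (pi / T) * x) \<le> measure (log_ratio c) {y. x \<le> y}"
        using C(2)[OF \<open>x \<ge> 0\<close>] by (simp flip: c(2))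
      also have "\<dots> = measure M (X i -` {y. x \<le> y} \<inter> space M)"
        unfolding law[of i, symmetric] by (subst measure_distr) auto
      also have "\<dots> \<le> P x"
        unfolding P_def
      proof (rule finite_measure_mono)
        show "X i -` {y. x \<le> y} \<inter> space M \<subseteq> {\<omega> \<in> space M. x \<le> lp_norm p (\<chi> i. X i \<omega>)}"
        proof clarsimp
          fix \<omega> assume "x \<le> X i \<omega>"
          then show "x \<le> lp_norm p (\<chi> i. X i \<omega>)"
            using abs_component_le_lp_norm[OF \<open>1 \<le> p\<close>, of "\<chi> i. X i \<omega>" i] by simp
        qed
      qed measurable
      finally show "C * exp (- (pi / T) * x) \<le> P x" .
    qed
  next
    fix l assume l: "0 \<le> l" "l < pi / T"
    \<comment> \<open>The constant of the Chernoff bound: by independence, the exponential moment of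
      the sum of the moduli, which dominates the norm, is this product.\<close>
    define k where "k = (\<Prod>i\<in>(UNIV :: 'n set). \<integral>\<^sup>+y. ennreal (exp (l * \<bar>y\<bar>)) \<partial>log_ratio c)"
    have "k < \<infinity>"
      using nn_integral_log_ratio_exp_abs_finite[OF c(1), of l] l
      by (auto simp: k_def c(2) power_eq_top_ennreal less_top[symmetric])
    have k: "(\<integral>\<^sup>+\<omega>. (\<Prod>i\<in>UNIV. ennreal (exp (l * \<bar>X i \<omega>\<bar>))) \<partial>M) = k"
    proof -
      have marginal: "(\<integral>\<^sup>+\<omega>. ennreal (exp (l * \<bar>X i \<omega>\<bar>)) \<partial>M) = (\<integral>\<^sup>+y. ennreal (exp (l * \<bar>y\<bar>)) \<partial>log_ratio c)" for i
        unfolding law[of i, symmetric] by (subst nn_integral_distr) auto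
      have "indep_vars (\<lambda>_. borel) (\<lambda>i \<omega>. ennreal (exp (l * \<bar>X i \<omega>\<bar>))) UNIV"
        by (rule indep_vars_compose2[OF assms(5)]) simp
      then have "(\<integral>\<^sup>+\<omega>. (\<Prod>i\<in>UNIV. ennreal (exp (l * \<bar>X i \<omega>\<bar>))) \<partial>M) = (\<Prod>i\<in>UNIV. \<integral>\<^sup>+\<omega>. ennreal (exp (l * \<bar>X i \<omega>\<bar>)) \<partial>M)"
        by (intro indep_vars_nn_integral) auto
      also have "\<dots> = k"
        unfolding k_def by (intro prod.cong refl marginal)
      finally show ?thesis .
    qed
    show "\<exists>K. \<forall>x\<ge>0. P x \<le> K * exp (- l * x)"
    proof (intro exI[of _ "enn2real k"] allI impI)
      fix x :: real assume "x \<ge> 0"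
      let ?A = "{\<omega> \<in> space M. x \<le> lp_norm p (\<chi> i. X i \<omega>)}"
      have "ennreal (exp (l * x)) * emeasure M ?A = (\<integral>\<^sup>+\<omega>. ennreal (exp (l * x)) * indicator ?A \<omega> \<partial>M)"
        by (subst nn_integral_cmult_indicator) auto
      also have "\<dots> \<le> (\<integral>\<^sup>+\<omega>. (\<Prod>i\<in>UNIV. ennreal (exp (l * \<bar>X i \<omega>\<bar>))) \<partial>M)"
      proof (rule nn_integral_mono)
        fix \<omega>
        have "exp (l * x) \<le> (\<Prod>i\<in>UNIV. exp (l * \<bar>X i \<omega>\<bar>))" if "\<omega> \<in> ?A"
        proof -
          have "x \<le> (\<Sum>i\<in>UNIV. \<bar>X i \<omega>\<bar>)"
            using that lp_norm_le_sum_abs[OF \<open>1 \<le> p\<close>, of "\<chi> i. X i \<omega>"] by simp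
          then have "l * x \<le> l * (\<Sum>i\<in>UNIV. \<bar>X i \<omega>\<bar>)" using l by (intro mult_left_mono) auto
          then show ?thesis by (simp add: exp_sum [symmetric] sum_distrib_left)
        qed
        then show "ennreal (exp (l * x)) * indicator ?A \<omega> \<le> (\<Prod>i\<in>UNIV. ennreal (exp (l * \<bar>X i \<omega>\<bar>)))"
          by (subst prod_ennreal) (auto simp: indicator_def intro!: ennreal_leI)
      qed
      also have "\<dots> = ennreal (enn2real k)" using k \<open>k < \<infinity>\<close> by simp
      finally have "exp (l * x) * P x \<le> enn2real k"
        by (simp add: P_def emeasure_eq_measure ennreal_mult' [symmetric])
      then show "P x \<le> enn2real k * exp (- l * x)"
        by (simp add: exp_minus field_simps)
    qed
  qed (use \<open>T > 0\<close> in simp)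
  then show ?thesis by (simp add: P_def)
qed

end
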